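(* Let $\mathcal L$ be the centerless $N=2$ superconformal Neveu-Schwarz algebra and let $\mathcal V=\mathcal L\otimes\mathcal L$, regarded as an $\mathcal L$-module under the adjoint diagonal action. Then $\mathrm{Der}(\mathcal L,\mathcal V)=\mathrm{Inn}(\mathcal L,\mathcal V)$; equivalently, $H^1(\mathcal L,\mathcal V)=0$.
   Context: All vector spaces are over $\mathbb C$. $\mathcal L=\mathcal L_{\bar0}\oplus\mathcal L_{\bar1}$ is the Lie superalgebra with basis $\{L_m, I_m, G_p^{\pm} \mid m\in\mathbb Z,\ p\in\mathbb Z+\tfrac12\}$, where $L_m,I_m$ are even, $G_p^\pm$ are odd, and for $m,n\in\mathbb Z$, $p,q\in\mathbb Z+\frac12$: $[L_m,L_n]=(m-n)L_{m+n}$, $[I_m,I_n]=0$, $[L_m,I_n]=-nI_{m+n}$, $[L_m,G_p^\pm]=(\frac m2-p)G_{p+m}^\pm$, $[I_m,G_p^\pm]=\pm G_{m+p}^\pm$, $[G_p^+,G_q^-]=2L_{p+q}+(p-q)I_{p+q}$, $[G_p^\pm,G_q^\pm]=0$. $[x]\in\mathbb Z_2$ denotes the parity of a homogeneous element $x$ (of a linear map, likewise). Whenever a parity appears in a formula the element is taken homogeneous, and formulas are extended linearly. The adjoint diagonal action of $\mathcal L$ on $\mathcal L\otimes\mathcal L$ is $x*\sum_i a_i\otimes b_i=\sum_i([x,a_i]\otimes b_i+(-1)^{[x][a_i]}a_i\otimes[x,b_i])$. For a Lie superalgebra $L=L_{\bar0}\oplus L_{\bar1}$ and an $L$-module $V=V_{\bar0}\oplus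 V_{\bar1}$ with action $*$, a $\mathbb Z_2$-homogeneous linear map $d:L\to V$ of degree $[d]$ (i.e. $d(L_i)\subset V_{i+[d]}$ for $i\in\mathbb Z_2$) is a homogeneous derivation of degree $[d]$ if $d([x,y])=(-1)^{[d][x]}x*d(y)-(-1)^{[y]([d]+[x])}y*d(x)$ for all $x,y\in L$. $\mathrm{Der}(L,V)=\mathrm{Der}_{\bar0}(L,V)\oplus\mathrm{Der}_{\bar1}(L,V)$, where $\mathrm{Der}_{\bar i}(L,V)$ is the space of homogeneous derivations of degree $\bar i$. For $a\in V_{\bar i}$ let $a_{\mathrm{inn}}:x\mapsto(-1)^{[a][x]}x*a$; $\mathrm{Inn}_{\bar i}(L,V)=\{a_{\mathrm{inn}}\mid a\in V_{\bar i}\}$ and $\mathrm{Inn}(L,V)=\mathrm{Inn}_{\bar0}(L,V)\oplus\mathrm{Inn}_{\bar1}(L,V)$. The first cohomology group is $H^1(L,V)\cong\mathrm{Der}(L,V)/\mathrm{Inn}(L,V)$. *)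

theory Defs
  imports Complex_Main "HOL-Library.Poly_Mapping" "HOL-Library.Z2"
begin

section \<open>Lie superalgebras, modules, derivations\<close>

text \<open>The sign \<open>(-1)\<^sup>p\<close> for a parity \<open>p \<in> \<int>\<^sub>2\<close>; products and sums of parities are taken in the
  field \<^typ>\<open>bit\<close>.\<close>

definition ksign :: "bit \<Rightarrow> complex" where
  "ksign p = (if p = 1 then - 1 else 1)"

locale super_space = vector_space scale
  for scale :: "complex \<Rightarrow> 'a::ab_group_add \<Rightarrow> 'a" +
  fixes gr :: "bit \<Rightarrow> 'a set"
  assumes subspace_gr: "subspace (gr i)"
    and gr_inter: "gr 0 \<inter> gr 1 = {0}"
    and gr_sum: "\<exists>u\<in>gr 0. \<exists>v\<in>gr 1. x = u + v"

locale lie_superalgebra = super_space scale gr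
  for scale :: "complex \<Rightarrow> 'a::ab_group_add \<Rightarrow> 'a" and gr :: "bit \<Rightarrow> 'a set" +
  fixes bracket :: "'a \<Rightarrow> 'a \<Rightarrow> 'a"
  assumes bracket_linear_left: "Vector_Spaces.linear scale scale (\<lambda>x. bracket x y)"
    and bracket_linear_right: "Vector_Spaces.linear scale scale (\<lambda>y. bracket x y)"
    and bracket_gr: "x \<in> gr i \<Longrightarrow> y \<in> gr j \<Longrightarrow> bracket x y \<in> gr (i + j)"
    and bracket_skew: "x \<in> gr i \<Longrightarrow> y \<in> gr j \<Longrightarrow> bracket x y = - scale (ksign (i * j)) (bracket y x)"
    and bracket_jacobi: "x \<in> gr i \<Longrightarrow> y \<in> gr j \<Longrightarrow>
      bracket x (bracket y z) = bracket (bracket x y) z + scale (ksign (i * j)) (bracket y (bracket x z))"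

locale lie_supermodule =
  L: lie_superalgebra scale gr bracket + V: super_space vscale vgr
  for scale :: "complex \<Rightarrow> 'a::ab_group_add \<Rightarrow> 'a" and gr :: "bit \<Rightarrow> 'a set"
    and bracket :: "'a \<Rightarrow> 'a \<Rightarrow> 'a"
    and vscale :: "complex \<Rightarrow> 'v::ab_group_add \<Rightarrow> 'v" and vgr :: "bit \<Rightarrow> 'v set" +
  fixes act :: "'a \<Rightarrow> 'v \<Rightarrow> 'v"
  assumes act_linear_left: "Vector_Spaces.linear scale vscale (\<lambda>x. act x v)"
    and act_linear_right: "Vector_Spaces.linear vscale vscale (\<lambda>v. act x v)"
    and act_gr: "x \<in> gr i \<Longrightarrow> v \<in> vgr j \<Longrightarrow> act x v \<in> vgr (i + j)"
    and act_bracket: "x \<in> gr i \<Longrightarrow> y \<in> gr j \<Longrightarrow>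
      act (bracket x y) v = act x (act y v) - vscale (ksign (i * j)) (act y (act x v))"
begin

definition Der_hom :: "bit \<Rightarrow> ('a \<Rightarrow> 'v) set" where
  "Der_hom p = {d. Vector_Spaces.linear scale vscale d \<and>
     (\<forall>i. d ` gr i \<subseteq> vgr (i + p)) \<and>
     (\<forall>i j. \<forall>x\<in>gr i. \<forall>y\<in>gr j.
        d (bracket x y) =
          vscale (ksign (p * i)) (act x (d y)) - vscale (ksign (j * (p + i))) (act y (d x)))}"

definition Der :: "('a \<Rightarrow> 'v) set" where
  "Der = {\<lambda>x. d0 x + d1 x | d0 d1. d0 \<in> Der_hom 0 \<and> d1 \<in> Der_hom 1}"

text \<open>For \<open>a\<close> of parity \<open>p\<close>, the map \<open>x \<mapsto> (-1)\<^bsup>[a][x]\<^esup> x * a\<close> is prescribed on homogeneous \<open>x\<close> and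
  extended linearly; a linear map on \<open>L\<close> is determined by its values on homogeneous elements.\<close>

definition Inn_hom :: "bit \<Rightarrow> ('a \<Rightarrow> 'v) set" where
  "Inn_hom p = {d. Vector_Spaces.linear scale vscale d \<and>
     (\<exists>a\<in>vgr p. \<forall>i. \<forall>x\<in>gr i. d x = vscale (ksign (p * i)) (act x a))}"

definition Inn :: "('a \<Rightarrow> 'v) set" where
  "Inn = {\<lambda>x. d0 x + d1 x | d0 d1. d0 \<in> Inn_hom 0 \<and> d1 \<in> Inn_hom 1}"

text \<open>The quotient space \<open>Der / Inn\<close> as a set of cosets; its zero is the coset \<open>Inn\<close>.\<close>

definition H1 :: "('a \<Rightarrow> 'v) set set" where
  "H1 = Der // {(d, e). d \<in> Der \<and> e \<in> Der \<and> (\<lambda>x. d x - e x) \<in> Inn}"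

end

section \<open>Free vector spaces and their tensor products\<close>

text \<open>The complex vector space with basis \<open>'a\<close> is \<^typ>\<open>'a \<Rightarrow>\<^sub>0 complex\<close>, the tensor product of the
  spaces with bases \<open>'a\<close> and \<open>'b\<close> is \<^typ>\<open>'a \<times> 'b \<Rightarrow>\<^sub>0 complex\<close>
  (see \<open>tensor_universal\<close> below for the universal property).\<close>

definition fscale :: "complex \<Rightarrow> ('a \<Rightarrow>\<^sub>0 complex) \<Rightarrow> ('a \<Rightarrow>\<^sub>0 complex)" where
  "fscale c x = Poly_Mapping.map ((*) c) x"

definition basis_vec :: "'a \<Rightarrow> ('a \<Rightarrow>\<^sub>0 complex)" where
  "basis_vec a = Poly_Mapping.single a 1"

definition lin_ext :: "(complex \<Rightarrow> 'v \<Rightarrow> 'v) \<Rightarrow> ('a \<Rightarrow> 'v::ab_group_add) \<Rightarrow> ('a \<Rightarrow>\<^sub>0 complex) \<Rightarrow> 'v" where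
  "lin_ext s f x = (\<Sum>a\<in>Poly_Mapping.keys x. s (Poly_Mapping.lookup x a) (f a))"

definition bilin_ext :: "(complex \<Rightarrow> 'v \<Rightarrow> 'v) \<Rightarrow> ('a \<Rightarrow> 'b \<Rightarrow> 'v::ab_group_add) \<Rightarrow>
    ('a \<Rightarrow>\<^sub>0 complex) \<Rightarrow> ('b \<Rightarrow>\<^sub>0 complex) \<Rightarrow> 'v" where
  "bilin_ext s f x y = lin_ext s (\<lambda>a. lin_ext s (f a) y) x"

definition tensor :: "('a \<Rightarrow>\<^sub>0 complex) \<Rightarrow> ('b \<Rightarrow>\<^sub>0 complex) \<Rightarrow> ('a \<times> 'b \<Rightarrow>\<^sub>0 complex)"
    (infixl \<open>\<otimes>\<^sub>t\<close> 75) where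
  "x \<otimes>\<^sub>t y = bilin_ext fscale (\<lambda>a b. basis_vec (a, b)) x y"

text \<open>The homogeneous component of parity \<open>i\<close> when each basis element \<open>a\<close> is given parity \<open>par a\<close>.\<close>

definition fgr :: "('a \<Rightarrow> bit) \<Rightarrow> bit \<Rightarrow> ('a \<Rightarrow>\<^sub>0 complex) set" where
  "fgr par i = {x. \<forall>a\<in>Poly_Mapping.keys x. par a = i}"

lemma lookup_fscale [simp]: "Poly_Mapping.lookup (fscale c x) a = c * Poly_Mapping.lookup x a"
  unfolding fscale_def by (simp add: Poly_Mapping.map.rep_eq when_def)

lemma fscale_single: "fscale c (Poly_Mapping.single a e) = Poly_Mapping.single a (c * e)"
  by (rule poly_mapping_eqI) (simp add: lookup_single when_def)

lemma vector_space_fscale: "vector_space fscale"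
  by unfold_locales (auto intro!: poly_mapping_eqI simp: lookup_add algebra_simps)

interpretation fs: vector_space fscale by (rule vector_space_fscale)

lemma lin_ext_superset:
  assumes "vector_space s" "finite A" "Poly_Mapping.keys x \<subseteq> A"
  shows "lin_ext s f x = (\<Sum>a\<in>A. s (Poly_Mapping.lookup x a) (f a))"
proof -
  interpret vector_space s by fact
  show ?thesis unfolding lin_ext_def
    by (rule sum.mono_neutral_left) (use assms in \<open>auto simp: in_keys_iff\<close>)
qed

lemma linear_lin_ext:
  assumes "vector_space s"
  shows "Vector_Spaces.linear fscale s (lin_ext s f)"
proof -
  interpret vector_space s by fact
  have add: "lin_ext s f (x + y) = lin_ext s f x + lin_ext s f y" for x y
  proof -
    let ?A = "Poly_Mapping.keys x \<union> Poly_Mapping.keys y"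
    have "lin_ext s f z = (\<Sum>a\<in>?A. s (Poly_Mapping.lookup z a) (f a))"
      if "Poly_Mapping.keys z \<subseteq> ?A" for z
      by (rule lin_ext_superset[OF assms]) (use that in auto)
    then show ?thesis
      by (simp add: Poly_Mapping.keys_add lookup_add scale_left_distrib sum.distrib)
  qed
  have scale: "lin_ext s f (fscale c x) = s c (lin_ext s f x)" for c x
  proof -
    have "lin_ext s f (fscale c x)
        = (\<Sum>a\<in>Poly_Mapping.keys x. s (Poly_Mapping.lookup (fscale c x) a) (f a))"
      by (rule lin_ext_superset[OF assms]) (auto simp: in_keys_iff)
    then show ?thesis by (simp add: lin_ext_def scale_sum_right)
  qed
  show ?thesis by unfold_locales (simp_all add: add scale)
qed

lemma lin_ext_basis [simp]:
  assumes "vector_space s" shows "lin_ext s f (basis_vec a) = f a"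
proof -
  interpret vector_space s by fact
  show ?thesis by (simp add: lin_ext_def basis_vec_def)
qed

lemma lin_ext_basis_vec: "lin_ext fscale basis_vec x = x"
proof (rule poly_mapping_eqI)
  fix k
  have "Poly_Mapping.lookup (lin_ext fscale basis_vec x) k
      = (\<Sum>a\<in>Poly_Mapping.keys x. if a = k then Poly_Mapping.lookup x k else 0)"
    unfolding lin_ext_def lookup_sum
    by (rule sum.cong) (auto simp: basis_vec_def lookup_single when_def)
  also have "\<dots> = Poly_Mapping.lookup x k" by (simp add: in_keys_iff)
  finally show "Poly_Mapping.lookup (lin_ext fscale basis_vec x) k = Poly_Mapping.lookup x k" .
qed

lemma linear_eq_lin_ext:
  assumes "Vector_Spaces.linear fscale s g"
  shows "g x = lin_ext s (\<lambda>a. g (basis_vec a)) x"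
proof -
  interpret g: Vector_Spaces.linear fscale s g by fact
  have "g (lin_ext fscale basis_vec x) = lin_ext s (\<lambda>a. g (basis_vec a)) x"
    by (simp add: lin_ext_def g.sum g.scale)
  then show ?thesis by (simp add: lin_ext_basis_vec)
qed

lemma linear_eqI_basis:
  assumes "Vector_Spaces.linear fscale s g" "Vector_Spaces.linear fscale s h"
    and "\<And>a. a \<in> Poly_Mapping.keys x \<Longrightarrow> g (basis_vec a) = h (basis_vec a)"
  shows "g x = h x"
proof -
  have "g x = lin_ext s (\<lambda>a. g (basis_vec a)) x" by (rule linear_eq_lin_ext) fact
  also have "\<dots> = lin_ext s (\<lambda>a. h (basis_vec a)) x" using assms(3) by (simp add: lin_ext_def)
  also have "\<dots> = h x" by (rule linear_eq_lin_ext[symmetric]) fact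
  finally show ?thesis .
qed

lemma linear_bilin_ext_left:
  "vector_space s \<Longrightarrow> Vector_Spaces.linear fscale s (\<lambda>x. bilin_ext s f x y)"
  unfolding bilin_ext_def by (rule linear_lin_ext)

lemma linear_bilin_ext_right:
  assumes "vector_space s"
  shows "Vector_Spaces.linear fscale s (\<lambda>y. bilin_ext s f x y)"
proof -
  interpret vector_space s by fact
  interpret l: Vector_Spaces.linear fscale s "lin_ext s (f a)" for a by (rule linear_lin_ext) fact
  show ?thesis
    by unfold_locales
      (simp_all add: bilin_ext_def lin_ext_def[of _ _ x] l.add l.scale scale_right_distrib
        sum.distrib scale_sum_right mult.commute)
qed

lemma bilin_ext_basis [simp]:
  "vector_space s \<Longrightarrow> bilin_ext s f (basis_vec a) (basis_vec b) = f a b"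
  by (simp add: bilin_ext_def)

lemma tensor_basis [simp]: "basis_vec a \<otimes>\<^sub>t basis_vec b = basis_vec (a, b)"
  by (simp add: tensor_def vector_space_fscale)

lemma linear_tensor_left: "Vector_Spaces.linear fscale fscale (\<lambda>x. x \<otimes>\<^sub>t y)"
  unfolding tensor_def by (rule linear_bilin_ext_left) (rule vector_space_fscale)

lemma linear_tensor_right: "Vector_Spaces.linear fscale fscale (\<lambda>y. x \<otimes>\<^sub>t y)"
  unfolding tensor_def by (rule linear_bilin_ext_right) (rule vector_space_fscale)

lemma bilinear_eqI_basis:
  assumes "\<And>y. Vector_Spaces.linear fscale s (\<lambda>x. g x y)" "\<And>y. Vector_Spaces.linear fscale s (\<lambda>x. h x y)"
    and "\<And>x. Vector_Spaces.linear fscale s (\<lambda>y. g x y)" "\<And>x. Vector_Spaces.linear fscale s (\<lambda>y. h x y)"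
    and "\<And>a b. a \<in> Poly_Mapping.keys x \<Longrightarrow> b \<in> Poly_Mapping.keys y \<Longrightarrow>
      g (basis_vec a) (basis_vec b) = h (basis_vec a) (basis_vec b)"
  shows "g x y = h x y"
proof (rule linear_eqI_basis[of s "\<lambda>x. g x y" "\<lambda>x. h x y"])
  fix a assume "a \<in> Poly_Mapping.keys x"
  then show "g (basis_vec a) y = h (basis_vec a) y"
    by (rule linear_eqI_basis[of s "g (basis_vec a)" "h (basis_vec a)", OF assms(3,4) assms(5)])
qed (rule assms(1,2))+

lemma tensor_universal:
  fixes f :: "('a \<Rightarrow>\<^sub>0 complex) \<Rightarrow> ('b \<Rightarrow>\<^sub>0 complex) \<Rightarrow> 'c::ab_group_add"
  assumes l: "\<And>y. Vector_Spaces.linear fscale s (\<lambda>x. f x y)"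
    and r: "\<And>x. Vector_Spaces.linear fscale s (\<lambda>y. f x y)"
  shows "\<exists>!g. Vector_Spaces.linear fscale s g \<and> (\<forall>x y. g (x \<otimes>\<^sub>t y) = f x y)"
proof
  interpret l: Vector_Spaces.linear fscale s "\<lambda>x. f x 0" by (rule l)
  have vs: "vector_space s" by (rule l.vs2.vector_space_axioms)
  let ?g = "lin_ext s (\<lambda>(a, b). f (basis_vec a) (basis_vec b))"
  have lg: "Vector_Spaces.linear fscale s ?g" by (rule linear_lin_ext) (rule vs)
  have "?g (x \<otimes>\<^sub>t y) = f x y" for x y
  proof (rule bilinear_eqI_basis[of s "\<lambda>x y. ?g (x \<otimes>\<^sub>t y)" f])
    show "Vector_Spaces.linear fscale s (\<lambda>x. ?g (x \<otimes>\<^sub>t y))" for y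
      using Vector_Spaces.linear_compose[OF linear_tensor_left lg] by (simp add: comp_def)
    show "Vector_Spaces.linear fscale s (\<lambda>y. ?g (x \<otimes>\<^sub>t y))" for x
      using Vector_Spaces.linear_compose[OF linear_tensor_right lg] by (simp add: comp_def)
    show "?g (basis_vec a \<otimes>\<^sub>t basis_vec b) = f (basis_vec a) (basis_vec b)" for a b
      by (simp add: vs)
  qed (rule l r)+
  with lg show "Vector_Spaces.linear fscale s ?g \<and> (\<forall>x y. ?g (x \<otimes>\<^sub>t y) = f x y)" by blast
  fix h assume h: "Vector_Spaces.linear fscale s h \<and> (\<forall>x y. h (x \<otimes>\<^sub>t y) = f x y)"
  show "h = ?g"
  proof
    fix t
    show "h t = ?g t"
    proof (rule linear_eqI_basis[of s])
      fix c :: "'a \<times> 'b"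
      obtain a b where c: "c = (a, b)" by fastforce
      have "h (basis_vec a \<otimes>\<^sub>t basis_vec b) = f (basis_vec a) (basis_vec b)" using h by blast
      then show "h (basis_vec c) = ?g (basis_vec c)" by (simp add: c vs)
    qed (use h lg in auto)
  qed
qed

lemma fgr_iff: "x \<in> fgr par i \<longleftrightarrow> (\<forall>a. par a \<noteq> i \<longrightarrow> Poly_Mapping.lookup x a = 0)"
  by (auto simp: fgr_def in_keys_iff)

lemma super_space_fgr: "super_space fscale (fgr par)"
proof
  show "fs.subspace (fgr par i)" for i
    unfolding fs.subspace_def by (simp add: fgr_iff lookup_add)
  show "fgr par 0 \<inter> fgr par 1 = {0}"
  proof -
    have "x = 0" if "x \<in> fgr par 0" "x \<in> fgr par 1" for x
    proof (rule poly_mapping_eqI)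
      show "Poly_Mapping.lookup x k = Poly_Mapping.lookup 0 k" for k
        using that by (cases "par k") (simp_all add: fgr_iff)
    qed
    then show ?thesis by (auto simp: fgr_iff)
  qed
  show "\<exists>u\<in>fgr par 0. \<exists>v\<in>fgr par 1. x = u + v" for x
  proof -
    define P where "P i = lin_ext fscale (\<lambda>a. if par a = i then basis_vec a else 0) x" for i
    have lk: "Poly_Mapping.lookup (P i) k = (if par k = i then Poly_Mapping.lookup x k else 0)" for i k
    proof -
      have "Poly_Mapping.lookup (P i) k
          = (\<Sum>a\<in>Poly_Mapping.keys x. if a = k then (if par k = i then Poly_Mapping.lookup x k else 0) else 0)"
        unfolding P_def lin_ext_def lookup_sum
        by (rule sum.cong) (auto simp: basis_vec_def lookup_single when_def)
      also have "\<dots> = (if par k = i then Poly_Mapping.lookup x k else 0)"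
        by (auto simp: in_keys_iff)
      finally show ?thesis .
    qed
    have "P i \<in> fgr par i" for i by (simp add: fgr_iff lk)
    moreover have "x = P 0 + P 1"
    proof (rule poly_mapping_eqI)
      show "Poly_Mapping.lookup x k = Poly_Mapping.lookup (P 0 + P 1) k" for k
        by (cases "par k") (simp_all add: lookup_add lk)
    qed
    ultimately show ?thesis by blast
  qed
qed

section \<open>The centerless N = 2 superconformal Neveu--Schwarz algebra\<close>

text \<open>The half-integer index \<open>p = k + 1/2\<close> of an odd generator is encoded by the integer \<open>k\<close>:
  \<open>Gplus k\<close> and \<open>Gminus k\<close> stand for \<open>G\<^sup>+\<close> and \<open>G\<^sup>-\<close> with index \<open>k + 1/2\<close>.  Thus \<open>p + q = k + l + 1\<close>
  and \<open>p - q = k - l\<close> for \<open>q = l + 1/2\<close>.\<close>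

datatype ns_basis = Lgen int | Igen int | Gplus int | Gminus int

fun ns_par :: "ns_basis \<Rightarrow> bit" where
  "ns_par (Lgen m) = 0"
| "ns_par (Igen m) = 0"
| "ns_par (Gplus k) = 1"
| "ns_par (Gminus k) = 1"

type_synonym ns = "ns_basis \<Rightarrow>\<^sub>0 complex"

definition half_idx :: "int \<Rightarrow> complex" where
  "half_idx k = of_int k + 1 / 2"

fun ns_brk :: "ns_basis \<Rightarrow> ns_basis \<Rightarrow> ns" where
  "ns_brk (Lgen m) (Lgen n) = fscale (of_int (m - n)) (basis_vec (Lgen (m + n)))"
| "ns_brk (Lgen m) (Igen n) = fscale (- of_int n) (basis_vec (Igen (m + n)))"
| "ns_brk (Lgen m) (Gplus k) = fscale (of_int m / 2 - half_idx k) (basis_vec (Gplus (m + k)))"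
| "ns_brk (Lgen m) (Gminus k) = fscale (of_int m / 2 - half_idx k) (basis_vec (Gminus (m + k)))"
| "ns_brk (Igen m) (Lgen n) = fscale (of_int m) (basis_vec (Igen (m + n)))"
| "ns_brk (Igen m) (Igen n) = 0"
| "ns_brk (Igen m) (Gplus k) = basis_vec (Gplus (m + k))"
| "ns_brk (Igen m) (Gminus k) = - basis_vec (Gminus (m + k))"
| "ns_brk (Gplus k) (Lgen m) = - fscale (of_int m / 2 - half_idx k) (basis_vec (Gplus (m + k)))"
| "ns_brk (Gplus k) (Igen m) = - basis_vec (Gplus (m + k))"
| "ns_brk (Gplus k) (Gplus l) = 0"
| "ns_brk (Gplus k) (Gminus l) =
     fscale 2 (basis_vec (Lgen (k + l + 1))) + fscale (half_idx k - half_idx l) (basis_vec (Igen (k + l + 1)))"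
| "ns_brk (Gminus k) (Lgen m) = - fscale (of_int m / 2 - half_idx k) (basis_vec (Gminus (m + k)))"
| "ns_brk (Gminus k) (Igen m) = basis_vec (Gminus (m + k))"
| "ns_brk (Gminus l) (Gplus k) =
     fscale 2 (basis_vec (Lgen (k + l + 1))) + fscale (half_idx k - half_idx l) (basis_vec (Igen (k + l + 1)))"
| "ns_brk (Gminus k) (Gminus l) = 0"

definition ns_bracket :: "ns \<Rightarrow> ns \<Rightarrow> ns" where
  "ns_bracket = bilin_ext fscale ns_brk"

abbreviation ns_gr :: "bit \<Rightarrow> ns set" where
  "ns_gr \<equiv> fgr ns_par"

type_synonym ns_tensor = "ns_basis \<times> ns_basis \<Rightarrow>\<^sub>0 complex"

definition ns_tensor_gr :: "bit \<Rightarrow> ns_tensor set" where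
  "ns_tensor_gr = fgr (\<lambda>(a, b). ns_par a + ns_par b)"

text \<open>The adjoint diagonal action, given on basis elements and extended bilinearly; the defining
  formula for arbitrary homogeneous elements is \<open>ns_act_tensor\<close> below.\<close>

definition ns_act :: "ns \<Rightarrow> ns_tensor \<Rightarrow> ns_tensor" where
  "ns_act = bilin_ext fscale (\<lambda>x (a, b).
     ns_brk x a \<otimes>\<^sub>t basis_vec b + fscale (ksign (ns_par x * ns_par a)) (basis_vec a \<otimes>\<^sub>t ns_brk x b))"

lemma ns_bracket_basis [simp]: "ns_bracket (basis_vec a) (basis_vec b) = ns_brk a b"
  by (simp add: ns_bracket_def vector_space_fscale)

lemma linear_bracket_left: "Vector_Spaces.linear fscale fscale (\<lambda>x. ns_bracket x y)"
  unfolding ns_bracket_def by (rule linear_bilin_ext_left) (rule vector_space_fscale)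

lemma linear_bracket_right: "Vector_Spaces.linear fscale fscale (\<lambda>y. ns_bracket x y)"
  unfolding ns_bracket_def by (rule linear_bilin_ext_right) (rule vector_space_fscale)

lemma linear_act_left: "Vector_Spaces.linear fscale fscale (\<lambda>x. ns_act x v)"
  unfolding ns_act_def by (rule linear_bilin_ext_left) (rule vector_space_fscale)

lemma linear_act_right: "Vector_Spaces.linear fscale fscale (\<lambda>v. ns_act x v)"
  unfolding ns_act_def by (rule linear_bilin_ext_right) (rule vector_space_fscale)

interpretation brl: Vector_Spaces.linear fscale fscale "\<lambda>x. ns_bracket x y" for y
  by (rule linear_bracket_left)
interpretation brr: Vector_Spaces.linear fscale fscale "\<lambda>y. ns_bracket x y" for x
  by (rule linear_bracket_right)
interpretation actl: Vector_Spaces.linear fscale fscale "\<lambda>x. ns_act x v" for v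
  by (rule linear_act_left)
interpretation actr: Vector_Spaces.linear fscale fscale "\<lambda>v. ns_act x v" for x
  by (rule linear_act_right)
interpretation tenl: Vector_Spaces.linear fscale fscale "\<lambda>x. x \<otimes>\<^sub>t y" for y :: "'b \<Rightarrow>\<^sub>0 complex"
  by (rule linear_tensor_left)
interpretation tenr: Vector_Spaces.linear fscale fscale "\<lambda>y. x \<otimes>\<^sub>t y" for x :: "'a \<Rightarrow>\<^sub>0 complex"
  by (rule linear_tensor_right)

lemmas ns_lin = brl.add brl.scale brl.neg brl.diff brl.zero brr.add brr.scale brr.neg brr.diff brr.zero
  actl.add actl.scale actl.neg actl.diff actl.zero actr.add actr.scale actr.neg actr.diff actr.zero
  tenl.add tenl.scale tenl.neg tenl.diff tenl.zero tenr.add tenr.scale tenr.neg tenr.diff tenr.zero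
  fs.scale_right_distrib fs.scale_left_distrib fs.scale_right_diff_distrib

lemma fgr_add: "x \<in> fgr par i \<Longrightarrow> y \<in> fgr par i \<Longrightarrow> x + y \<in> fgr par i"
  by (simp add: fgr_iff lookup_add)

lemma fgr_neg: "x \<in> fgr par i \<Longrightarrow> - x \<in> fgr par i"
  by (simp add: fgr_iff)

lemma fgr_scale: "x \<in> fgr par i \<Longrightarrow> fscale c x \<in> fgr par i"
  by (simp add: fgr_iff)

lemma fgr_sum: "(\<And>a. a \<in> A \<Longrightarrow> f a \<in> fgr par i) \<Longrightarrow> sum f A \<in> fgr par i"
  by (simp add: fgr_iff lookup_sum)

lemma fgr_basis: "par a = i \<Longrightarrow> basis_vec a \<in> fgr par i"
  by (auto simp: fgr_iff basis_vec_def lookup_single when_def)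

lemma fgr_bilin_ext:
  assumes "\<And>a b. a \<in> Poly_Mapping.keys x \<Longrightarrow> b \<in> Poly_Mapping.keys y \<Longrightarrow> f a b \<in> fgr par i"
  shows "bilin_ext fscale f x y \<in> fgr par i"
  unfolding bilin_ext_def lin_ext_def by (intro fgr_sum fgr_scale assms)

lemma fgr_tensor: "x \<in> fgr par i \<Longrightarrow> y \<in> fgr par' j \<Longrightarrow> x \<otimes>\<^sub>t y \<in> fgr (\<lambda>(a, b). par a + par' b) (i + j)"
  unfolding tensor_def by (intro fgr_bilin_ext fgr_basis) (simp add: fgr_def)

lemma lookup_basis_vec: "Poly_Mapping.lookup (basis_vec a) b = (if a = b then 1 else 0)"
  by (simp add: basis_vec_def lookup_single when_def)

lemma ns_brk_gr: "ns_brk a b \<in> ns_gr (ns_par a + ns_par b)"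
  by (cases a; cases b) (auto intro!: fgr_add fgr_neg fgr_scale fgr_basis simp: fgr_iff[of 0])

lemma ns_brk_skew: "ns_brk a b = - fscale (ksign (ns_par a * ns_par b)) (ns_brk b a)"
  by (cases a; cases b; intro poly_mapping_eqI)
    (auto simp: ksign_def lookup_add lookup_basis_vec half_idx_def algebra_simps)

lemma ns_brk_jacobi:
  "ns_bracket (basis_vec a) (ns_brk b c) =
     ns_bracket (ns_brk a b) (basis_vec c)
     + fscale (ksign (ns_par a * ns_par b)) (ns_bracket (basis_vec b) (ns_brk a c))"
  by (cases a; cases b; cases c)
    (simp_all add: ksign_def ns_lin, (auto intro!: poly_mapping_eqI simp: lookup_add lookup_basis_vec half_idx_def field_simps)?)

lemma ns_bracket_gr: "x \<in> ns_gr i \<Longrightarrow> y \<in> ns_gr j \<Longrightarrow> ns_bracket x y \<in> ns_gr (i + j)"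
  unfolding ns_bracket_def
  by (rule fgr_bilin_ext) (use ns_brk_gr in \<open>auto simp: fgr_def\<close>)

lemma ns_bracket_skew:
  assumes "x \<in> ns_gr i" "y \<in> ns_gr j"
  shows "ns_bracket x y = - fscale (ksign (i * j)) (ns_bracket y x)"
proof (rule bilinear_eqI_basis[of fscale ns_bracket "\<lambda>x y. - fscale (ksign (i * j)) (ns_bracket y x)"])
  fix a b assume "a \<in> Poly_Mapping.keys x" "b \<in> Poly_Mapping.keys y"
  then have "ns_par a = i" "ns_par b = j" using assms by (auto simp: fgr_def)
  then show "ns_bracket (basis_vec a) (basis_vec b)
      = - fscale (ksign (i * j)) (ns_bracket (basis_vec b) (basis_vec a))"
    using ns_brk_skew[of a b] by simp
next
  show "Vector_Spaces.linear fscale fscale (\<lambda>x. - fscale (ksign (i * j)) (ns_bracket y x))" for y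
    by unfold_locales (simp_all add: ns_lin mult.commute)
  show "Vector_Spaces.linear fscale fscale (\<lambda>y. - fscale (ksign (i * j)) (ns_bracket y x))" for x
    by unfold_locales (simp_all add: ns_lin mult.commute)
qed (rule linear_bracket_left linear_bracket_right)+

lemma ns_bracket_jacobi:
  assumes x: "x \<in> ns_gr i" and y: "y \<in> ns_gr j"
  shows "ns_bracket x (ns_bracket y z) =
    ns_bracket (ns_bracket x y) z + fscale (ksign (i * j)) (ns_bracket y (ns_bracket x z))"
    (is "?l x y z = ?r x y z")
proof -
  have lin: "Vector_Spaces.linear fscale fscale (\<lambda>z. ?l x y z)"
      "Vector_Spaces.linear fscale fscale (\<lambda>z. ?r x y z)"
      "Vector_Spaces.linear fscale fscale (\<lambda>y. ?l x y z)"
      "Vector_Spaces.linear fscale fscale (\<lambda>y. ?r x y z)"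
      "Vector_Spaces.linear fscale fscale (\<lambda>x. ?l x y z)"
      "Vector_Spaces.linear fscale fscale (\<lambda>x. ?r x y z)" for x y z
    by (unfold_locales; simp add: ns_lin mult.commute)+
  have "?l (basis_vec a) (basis_vec b) z = ?r (basis_vec a) (basis_vec b) z"
    if "a \<in> Poly_Mapping.keys x" "b \<in> Poly_Mapping.keys y" for a b
  proof (rule linear_eqI_basis[OF lin(1,2)])
    have "ns_par a = i" "ns_par b = j" using that x y by (auto simp: fgr_def)
    then show "?l (basis_vec a) (basis_vec b) (basis_vec c) = ?r (basis_vec a) (basis_vec b) (basis_vec c)" for c
      using ns_brk_jacobi[of a b c] by simp
  qed
  then show ?thesis
    by (rule bilinear_eqI_basis[of fscale "\<lambda>x y. ?l x y z" "\<lambda>x y. ?r x y z", OF lin(5,6,3,4)])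
qed

lemma ns_act_tensor:
  assumes x: "x \<in> ns_gr i" and a: "a \<in> ns_gr j"
  shows "ns_act x (a \<otimes>\<^sub>t b) =
    ns_bracket x a \<otimes>\<^sub>t b + fscale (ksign (i * j)) (a \<otimes>\<^sub>t ns_bracket x b)"
    (is "?l x a b = ?r x a b")
proof -
  have lin: "Vector_Spaces.linear fscale fscale (\<lambda>b. ?l x a b)"
      "Vector_Spaces.linear fscale fscale (\<lambda>b. ?r x a b)"
      "Vector_Spaces.linear fscale fscale (\<lambda>a. ?l x a b)"
      "Vector_Spaces.linear fscale fscale (\<lambda>a. ?r x a b)"
      "Vector_Spaces.linear fscale fscale (\<lambda>x. ?l x a b)"
      "Vector_Spaces.linear fscale fscale (\<lambda>x. ?r x a b)" for x a b
    by (unfold_locales; simp add: ns_lin mult.commute)+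
  have "?l (basis_vec e) (basis_vec f) b = ?r (basis_vec e) (basis_vec f) b"
    if "e \<in> Poly_Mapping.keys x" "f \<in> Poly_Mapping.keys a" for e f
  proof (rule linear_eqI_basis[OF lin(1,2)])
    have "ns_par e = i" "ns_par f = j" using that x a by (auto simp: fgr_def)
    then show "?l (basis_vec e) (basis_vec f) (basis_vec g) = ?r (basis_vec e) (basis_vec f) (basis_vec g)" for g
      by (simp add: ns_act_def vector_space_fscale)
  qed
  then show ?thesis
    by (rule bilinear_eqI_basis[of fscale "\<lambda>x a. ?l x a b" "\<lambda>x a. ?r x a b", OF lin(5,6,3,4)])
qed

lemma ns_act_gr: "x \<in> ns_gr i \<Longrightarrow> v \<in> ns_tensor_gr j \<Longrightarrow> ns_act x v \<in> ns_tensor_gr (i + j)"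
  unfolding ns_act_def ns_tensor_gr_def
proof (rule fgr_bilin_ext, clarify)
  fix e a b assume "e \<in> Poly_Mapping.keys x" "(a, b) \<in> Poly_Mapping.keys v"
    and "x \<in> ns_gr i" "v \<in> fgr (\<lambda>(a, b). ns_par a + ns_par b) j"
  then have ij: "i = ns_par e" "j = ns_par a + ns_par b" by (auto simp: fgr_def)
  have "ns_brk e a \<otimes>\<^sub>t basis_vec b \<in> fgr (\<lambda>(a, b). ns_par a + ns_par b) ((ns_par e + ns_par a) + ns_par b)"
    by (intro fgr_tensor ns_brk_gr fgr_basis refl)
  moreover have "basis_vec a \<otimes>\<^sub>t ns_brk e b \<in> fgr (\<lambda>(a, b). ns_par a + ns_par b) (ns_par a + (ns_par e + ns_par b))"
    by (intro fgr_tensor ns_brk_gr fgr_basis refl)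
  ultimately show "ns_brk e a \<otimes>\<^sub>t basis_vec b
      + fscale (ksign (ns_par e * ns_par a)) (basis_vec a \<otimes>\<^sub>t ns_brk e b)
      \<in> fgr (\<lambda>(a, b). ns_par a + ns_par b) (i + j)"
    unfolding ij by (intro fgr_add fgr_scale) (simp_all only: ac_simps)
qed

lemma ns_act_bracket:
  assumes x: "x \<in> ns_gr i" and y: "y \<in> ns_gr j"
  shows "ns_act (ns_bracket x y) v = ns_act x (ns_act y v) - fscale (ksign (i * j)) (ns_act y (ns_act x v))"
    (is "?l v = ?r v")
proof (rule linear_eqI_basis[of fscale ?l ?r])
  fix c :: "ns_basis \<times> ns_basis"
  obtain e f where c: "c = (e, f)" by fastforce
  let ?a = "basis_vec e :: ns" and ?b = "basis_vec f :: ns" and ?k = "ns_par e"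
  have a: "?a \<in> ns_gr ?k" by (simp add: fgr_basis)
  note xa = ns_bracket_gr[OF x a] and ya = ns_bracket_gr[OF y a] and xy = ns_bracket_gr[OF x y]
  have "?l (?a \<otimes>\<^sub>t ?b) = ?r (?a \<otimes>\<^sub>t ?b)"
    apply (simp only: ns_lin ns_act_tensor[OF x a] ns_act_tensor[OF y a] ns_act_tensor[OF xy a]
        ns_act_tensor[OF x ya] ns_act_tensor[OF y xa] ns_bracket_jacobi[OF x y])
    apply (cases i; cases j; cases ?k)
    apply (simp_all add: ksign_def ns_lin)
    done
  then show "?l (basis_vec c) = ?r (basis_vec c)" by (simp add: c)
qed (unfold_locales; simp add: ns_lin mult.commute)+

interpretation NS: lie_supermodule fscale ns_gr ns_bracket fscale ns_tensor_gr ns_act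
proof (intro_locales)
  show "super_space_axioms fscale ns_gr" by (rule super_space.axioms(2)) (rule super_space_fgr)
  show "super_space_axioms fscale ns_tensor_gr"
    unfolding ns_tensor_gr_def by (rule super_space.axioms(2)) (rule super_space_fgr)
  show "lie_superalgebra_axioms fscale ns_gr ns_bracket"
    by unfold_locales (fact linear_bracket_left linear_bracket_right ns_bracket_gr ns_bracket_skew
        ns_bracket_jacobi)+
  show "lie_supermodule_axioms fscale ns_gr ns_bracket fscale ns_tensor_gr ns_act"
    by unfold_locales (fact linear_act_left linear_act_right ns_act_gr ns_act_bracket)+
qed

end

theory Submission
  imports Defs
begin

text \<open>
  The proof rests on a twisted basis of the algebra: \<open>L'\<^sub>m = L\<^sub>m + (1 - m)/2 I\<^sub>m\<close>, \<open>I\<^sub>m\<close>,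
  \<open>P\<^sub>m = G\<^sup>+\<close> with index \<open>m + 1/2\<close> and \<open>M\<^sub>m = G\<^sup>-\<close> with index \<open>m - 1/2\<close>.  In it
  \<open>[I\<^sub>m, L'\<^sub>n] = m I\<close>, \<open>[I\<^sub>m, P\<^sub>n] = P\<close>, \<open>[I\<^sub>m, M\<^sub>n] = - M\<close>, \<open>[P\<^sub>m, L'\<^sub>n] = m P\<close>,
  \<open>[P\<^sub>m, I\<^sub>n] = - P\<close> and \<open>[P\<^sub>m, M\<^sub>n] = 2 L' + 2 m I\<close>, all with index \<open>m + n\<close> on the right: the
  coefficients do not depend on \<open>n\<close>.  An element of the tensor square is the same as a family of Laurent
  polynomials in \<open>x\<close> and \<open>y\<close>, one for each pair of letters, where \<open>x\<^sup>iy\<^sup>j\<close> in the component of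
  \<open>LI\<close>, say, stands for \<open>L'\<^sub>i \<otimes> I\<^sub>j\<close>.  By the above, \<open>I\<^sub>m\<close> and \<open>P\<^sub>m\<close> act by matrices whose
  entries are constant multiples of \<open>x\<^sup>m\<close> and \<open>y\<^sup>m\<close>.  Hence the identities satisfied by a derivation
  become polynomial identities, in which \<open>x - y\<close> can be cancelled (\<open>diagonal_cancel\<close>).

  Let \<open>d\<close> be a homogeneous derivation.  Inner derivations are subtracted from it until nothing is left.

  \<^item> \<open>I\<^sub>0\<close> acts diagonalizably, its eigenvalue being the charge.  So \<open>d(I\<^sub>0)\<close> is \<open>I\<^sub>0 * u\<close> up to a
  term of charge zero.  That term is an invariant of the module and therefore zero
  (\<open>Der_hom_reduce_I0\<close>).  Once \<open>d(I\<^sub>0) = 0\<close>, the derivation preserves the charge.  As the charge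
  determines the parity, this finishes the odd case (\<open>odd_Der_hom_zero\<close>).

  \<^item> For even \<open>d\<close>, the operator \<open>P\<^sub>0\<close> squares to zero and is exact on the tensor square, while
  \<open>[P\<^sub>0, P\<^sub>0] = 0\<close> gives \<open>P\<^sub>0 * d(P\<^sub>0) = 0\<close>.  So \<open>d(P\<^sub>0) = P\<^sub>0 * u\<close> (\<open>P0_exact\<close>).

  \<^item> If \<open>d(P\<^sub>0) = 0\<close>, then \<open>d(P\<^sub>n) = - P\<^sub>0 * d(I\<^sub>n)\<close>, and the brackets of \<open>I\<^sub>1\<close> with \<open>I\<^sub>2\<close>,
  \<open>P\<^sub>1\<close> and \<open>M\<^sub>1\<close> restrict \<open>d(I\<^sub>1)\<close> so much that \<open>d(I\<^sub>1) = I\<^sub>1 * u\<close> with \<open>P\<^sub>0 * u = 0\<close>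
  (\<open>LI_IL_exact\<close> and \<open>I1_exact\<close>).  The crucial point is that two components of \<open>d(I\<^sub>1)\<close> are divisible
  by \<open>x - y\<close>.  This uses the bracket with \<open>M\<^sub>1\<close>: the subalgebra spanned by the \<open>I\<^sub>n\<close> and \<open>P\<^sub>n\<close> alone
  has outer derivations into the tensor square, for which these components do not vanish at \<open>x = y\<close>.

  \<^item> A derivation that kills \<open>I\<^sub>0\<close>, \<open>P\<^sub>0\<close> and \<open>I\<^sub>1\<close> is zero (\<open>zero_if_I1_zero\<close>).

  Every \<open>u\<close> above is given by an explicit formula in finitely many values of \<open>d\<close>, so it is a finite sum
  and no completion of the tensor square is involved.
\<close>

section \<open>Twisted coordinates\<close>

text \<open>The coordinate functionals of the twisted basis, expressed through the coordinates \<open>f\<close> of a vector in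
  the given basis.  \<open>Lgen\<close>, \<open>Igen\<close>, \<open>Gplus\<close>, \<open>Gminus\<close> in the first argument stand for
  \<open>L'\<close>, \<open>I\<close>, \<open>P\<close>, \<open>M\<close>.\<close>

fun twisted_coord :: "ns_basis \<Rightarrow> (ns_basis \<Rightarrow> complex) \<Rightarrow> complex" where
  "twisted_coord (Lgen i) f = f (Lgen i)"
| "twisted_coord (Igen i) f = f (Igen i) - (1 - of_int i) / 2 * f (Lgen i)"
| "twisted_coord (Gplus i) f = f (Gplus i)"
| "twisted_coord (Gminus i) f = f (Gminus (i - 1))"

fun twisted_vec :: "ns_basis \<Rightarrow> ns" where
  "twisted_vec (Lgen i) = basis_vec (Lgen i) + fscale ((1 - of_int i) / 2) (basis_vec (Igen i))"
| "twisted_vec (Igen i) = basis_vec (Igen i)"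
| "twisted_vec (Gplus i) = basis_vec (Gplus i)"
| "twisted_vec (Gminus i) = basis_vec (Gminus (i - 1))"

definition tcoef :: "ns_tensor \<Rightarrow> ns_basis \<Rightarrow> ns_basis \<Rightarrow> complex" where
  "tcoef v a b = twisted_coord a (\<lambda>c. twisted_coord b (\<lambda>e. Poly_Mapping.lookup v (c, e)))"

lemma tcoef_add [simp]: "tcoef (u + v) a b = tcoef u a b + tcoef v a b"
  and tcoef_scale [simp]: "tcoef (fscale c v) a b = c * tcoef v a b"
  by (cases a; cases b; simp add: tcoef_def lookup_add algebra_simps)+

lemma tcoef_zero [simp]: "tcoef 0 a b = 0"
  by (cases a; cases b) (simp_all add: tcoef_def)

lemma tcoef_uminus [simp]: "tcoef (- v) a b = - tcoef v a b"
  using tcoef_add[of v "- v" a b] by (simp add: add_eq_0_iff)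

lemma tcoef_diff [simp]: "tcoef (u - v) a b = tcoef u a b - tcoef v a b"
  using tcoef_add[of u "- v" a b] by simp

lemma tcoef_sum: "tcoef (sum f A) a b = (\<Sum>x\<in>A. tcoef (f x) a b)"
  by (induction A rule: infinite_finite_induct) simp_all

lemma lookup_tensor:
  "Poly_Mapping.lookup (x \<otimes>\<^sub>t y) (c, e) = Poly_Mapping.lookup x c * Poly_Mapping.lookup y e"
proof (rule bilinear_eqI_basis[of "(*)" "\<lambda>x y. Poly_Mapping.lookup (x \<otimes>\<^sub>t y) (c, e)"
      "\<lambda>x y. Poly_Mapping.lookup x c * Poly_Mapping.lookup y e"])
qed (unfold_locales; simp add: ns_lin lookup_add lookup_basis_vec algebra_simps)+

lemma tcoef_tensor:
  "tcoef (x \<otimes>\<^sub>t y) a b = twisted_coord a (Poly_Mapping.lookup x) * twisted_coord b (Poly_Mapping.lookup y)"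
  by (cases a; cases b) (simp_all add: tcoef_def lookup_tensor field_simps)

lemma twisted_coord_inj:
  assumes "\<And>a. ns_par a = ns_par c \<Longrightarrow> twisted_coord a f = 0"
  shows "f c = 0"
proof (cases c)
  case (Lgen i) then show ?thesis using assms[of "Lgen i"] by simp
next
  case (Igen i) then show ?thesis using assms[of "Igen i"] assms[of "Lgen i"] by simp
next
  case (Gplus i) then show ?thesis using assms[of "Gplus i"] by simp
next
  case (Gminus i) then show ?thesis using assms[of "Gminus (i + 1)"] by simp
qed

lemma lookup_eq_tcoef:
  assumes "\<And>a b. tcoef u a b = tcoef v a b"
  shows "Poly_Mapping.lookup u (c, e) = Poly_Mapping.lookup v (c, e)"
proof -
  define w where "w = u - v"
  have z: "twisted_coord a (\<lambda>c. twisted_coord b (\<lambda>e. Poly_Mapping.lookup w (c, e))) = 0" for a b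
    using assms[of a b] tcoef_diff[of u v a b] by (simp add: w_def tcoef_def)
  have "twisted_coord b (\<lambda>e. Poly_Mapping.lookup w (c, e)) = 0" for b c
    by (rule twisted_coord_inj) (rule z)
  then have "Poly_Mapping.lookup w (c, e) = 0"
    by (rule twisted_coord_inj)
  then show ?thesis by (simp add: w_def lookup_minus)
qed

lemma tensor_eqI_tcoef: "(\<And>a b. tcoef u a b = tcoef v a b) \<Longrightarrow> u = v"
  by (rule poly_mapping_eqI) (metis lookup_eq_tcoef surj_pair)

lemma twisted_coord_twisted_vec: "twisted_coord a (Poly_Mapping.lookup (twisted_vec b)) = (if a = b then 1 else 0)"
  by (cases a; cases b) (auto simp: lookup_add lookup_basis_vec)

lemma tcoef_surj:
  assumes "finite {(a, b). F a b \<noteq> 0}"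
  obtains v where "\<And>a b. tcoef v a b = F a b"
proof
  define v where "v = (\<Sum>(a, b)\<in>{(a, b). F a b \<noteq> 0}. fscale (F a b) (twisted_vec a \<otimes>\<^sub>t twisted_vec b))"
  fix a b
  have "tcoef v a b = (\<Sum>p\<in>{(a, b). F a b \<noteq> 0}. if p = (a, b) then F a b else 0)"
    unfolding v_def tcoef_sum
    by (rule sum.cong) (auto simp: tcoef_tensor twisted_coord_twisted_vec split: if_splits)
  also have "\<dots> = F a b" using assms by simp
  finally show "tcoef v a b = F a b" .
qed

lemma finite_tcoef_support: "finite {(a, b). tcoef v a b \<noteq> 0}"
proof -
  let ?K = "Poly_Mapping.keys v"
  define N where "N c = (case c of Lgen i \<Rightarrow> {Lgen i, Igen i} | Igen i \<Rightarrow> {Igen i}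
    | Gplus i \<Rightarrow> {Gplus i} | Gminus i \<Rightarrow> {Gminus (i + 1)})" for c
  have N: "\<exists>c. f c \<noteq> 0 \<and> a \<in> N c" if "twisted_coord a f \<noteq> 0" for a and f :: "ns_basis \<Rightarrow> complex"
  proof (cases a)
    case (Lgen i) then show ?thesis using that by (intro exI[of _ "Lgen i"]) (simp add: N_def)
  next
    case (Igen i)
    show ?thesis
    proof (cases "f (Igen i) = 0")
      case True
      then show ?thesis using that Igen by (intro exI[of _ "Lgen i"]) (simp add: N_def)
    next
      case False
      then show ?thesis using Igen by (intro exI[of _ "Igen i"]) (simp add: N_def)
    qed
  next
    case (Gplus i) then show ?thesis using that by (intro exI[of _ "Gplus i"]) (simp add: N_def)
  next
    case (Gminus i) then show ?thesis using that by (intro exI[of _ "Gminus (i - 1)"]) (simp add: N_def)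
  qed
  have "finite (N c)" for c by (cases c) (simp_all add: N_def)
  then have "finite (\<Union>(c, e)\<in>?K. N c \<times> N e)" by auto
  moreover have "{(a, b). tcoef v a b \<noteq> 0} \<subseteq> (\<Union>(c, e)\<in>?K. N c \<times> N e)"
  proof clarify
    fix a b assume "tcoef v a b \<noteq> 0"
    then obtain c where c: "twisted_coord b (\<lambda>e. Poly_Mapping.lookup v (c, e)) \<noteq> 0" "a \<in> N c"
      unfolding tcoef_def using N by blast
    then obtain e where "Poly_Mapping.lookup v (c, e) \<noteq> 0" "b \<in> N e" using N by blast
    then show "(a, b) \<in> (\<Union>(c, e)\<in>?K. N c \<times> N e)" using c by (force simp: in_keys_iff)
  qed
  ultimately show ?thesis by (rule finite_subset[rotated])
qed

text \<open>The twist mixes only basis vectors of the same parity, so the grading can be read off in either basis.\<close>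

lemma tcoef_gr_iff:
  "v \<in> ns_tensor_gr p \<longleftrightarrow> (\<forall>a b. ns_par a + ns_par b \<noteq> p \<longrightarrow> tcoef v a b = 0)"
proof
  assume "v \<in> ns_tensor_gr p"
  then have *: "Poly_Mapping.lookup v (c, e) = 0" if "ns_par c + ns_par e \<noteq> p" for c e
    using that by (simp add: ns_tensor_gr_def fgr_iff)
  have "twisted_coord a f = 0" if "\<And>c. ns_par c = ns_par a \<Longrightarrow> f c = 0" for a and f :: "ns_basis \<Rightarrow> complex"
    by (cases a) (simp_all add: that)
  then show "\<forall>a b. ns_par a + ns_par b \<noteq> p \<longrightarrow> tcoef v a b = 0"
    unfolding tcoef_def by (metis *)
next
  assume *: "\<forall>a b. ns_par a + ns_par b \<noteq> p \<longrightarrow> tcoef v a b = 0"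
  have "Poly_Mapping.lookup v (c, e) = 0" if "ns_par c + ns_par e \<noteq> p" for c e
  proof -
    have "twisted_coord b (\<lambda>e. Poly_Mapping.lookup v (c, e)) = 0" if "ns_par b = ns_par e" for b
      by (rule twisted_coord_inj) (use * that \<open>ns_par c + ns_par e \<noteq> p\<close> in \<open>simp add: tcoef_def\<close>)
    then show ?thesis by (rule twisted_coord_inj)
  qed
  then show "v \<in> ns_tensor_gr p" by (auto simp: ns_tensor_gr_def fgr_iff)
qed

section \<open>The action in twisted coordinates\<close>

text \<open>The transposed adjoint actions of \<open>I\<^sub>m\<close>, \<open>P\<^sub>m\<close>, \<open>M\<^sub>m\<close>: if \<open>f\<close> lists the twisted coordinates of
  \<open>v\<close>, then \<open>coI m a f\<close> is the coordinate at \<open>a\<close> of \<open>[I\<^sub>m, v]\<close>.  Only in the last of the three do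
  the coefficients depend on the index \<open>i\<close>.\<close>

fun coI :: "int \<Rightarrow> ns_basis \<Rightarrow> (ns_basis \<Rightarrow> complex) \<Rightarrow> complex" where
  "coI m (Lgen i) f = 0"
| "coI m (Igen i) f = of_int m * f (Lgen (i - m))"
| "coI m (Gplus i) f = f (Gplus (i - m))"
| "coI m (Gminus i) f = - f (Gminus (i - m))"

fun coP :: "int \<Rightarrow> ns_basis \<Rightarrow> (ns_basis \<Rightarrow> complex) \<Rightarrow> complex" where
  "coP m (Lgen i) f = 2 * f (Gminus (i - m))"
| "coP m (Igen i) f = 2 * of_int m * f (Gminus (i - m))"
| "coP m (Gplus i) f = of_int m * f (Lgen (i - m)) - f (Igen (i - m))"
| "coP m (Gminus i) f = 0"

fun coM :: "int \<Rightarrow> ns_basis \<Rightarrow> (ns_basis \<Rightarrow> complex) \<Rightarrow> complex" where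
  "coM m (Lgen i) f = 2 * f (Gplus (i - m))"
| "coM m (Igen i) f = 2 * of_int (i - m) * f (Gplus (i - m))"
| "coM m (Gplus i) f = 0"
| "coM m (Gminus i) f = of_int (2 * m - i) * f (Lgen (i - m)) + f (Igen (i - m))"

text \<open>On the second factor the Koszul sign involves the parity of the first one.  The functional at \<open>a\<close>
  vanishes on basis vectors of the other parity, so the sign may be read off from \<open>a\<close>.\<close>

lemma tcoef_act_transpose:
  assumes brk: "\<And>a c. twisted_coord a (Poly_Mapping.lookup (ns_brk x c)) = co a (\<lambda>a'. twisted_coord a' (Poly_Mapping.lookup (basis_vec c)))"
    and add: "\<And>a f g. co a (\<lambda>c. f c + g c) = co a f + co a g"
    and scale: "\<And>a f k. co a (\<lambda>c. k * f c) = k * co a f"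
  shows "tcoef (ns_act (basis_vec x) v) a b =
    co a (\<lambda>a'. tcoef v a' b) + ksign (ns_par x * ns_par a) * co b (\<lambda>b'. tcoef v a b')"
proof (rule linear_eqI_basis[of "(*)" "\<lambda>v. tcoef (ns_act (basis_vec x) v) a b"
     "\<lambda>v. co a (\<lambda>a'. tcoef v a' b) + ksign (ns_par x * ns_par a) * co b (\<lambda>b'. tcoef v a b')"])
  fix k :: "ns_basis \<times> ns_basis"
  obtain c e where k: "k = (c, e)" by fastforce
  have par: "twisted_coord a (Poly_Mapping.lookup (basis_vec c)) = 0" if "ns_par a \<noteq> ns_par c"
    using that by (cases a; cases c) (simp_all add: lookup_basis_vec)
  have scale': "co a (\<lambda>c. f c * k) = co a f * k" for a f k
    using scale[of a k f] by (simp add: mult.commute)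
  have zero: "co a (\<lambda>_. 0) = 0" for a using scale[of a 0] by simp
  have t: "tcoef (basis_vec (c, e)) a b
     = twisted_coord a (Poly_Mapping.lookup (basis_vec c)) * twisted_coord b (Poly_Mapping.lookup (basis_vec e))" for a b
    using tcoef_tensor[of "basis_vec c" "basis_vec e" a b] by simp
  show "tcoef (ns_act (basis_vec x) (basis_vec k)) a b =
    co a (\<lambda>a'. tcoef (basis_vec k) a' b)
    + ksign (ns_par x * ns_par a) * co b (\<lambda>b'. tcoef (basis_vec k) a b')"
    using par
    by (cases "ns_par a = ns_par c")
      (simp_all add: k ns_act_def vector_space_fscale tcoef_tensor brk t scale scale' zero)
qed (unfold_locales; simp add: ns_lin add scale algebra_simps)+

lemma tcoef_act_I: "tcoef (ns_act (basis_vec (Igen m)) v) a b =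
    coI m a (\<lambda>a'. tcoef v a' b) + coI m b (\<lambda>b'. tcoef v a b')"
proof -
  have "tcoef (ns_act (basis_vec (Igen m)) v) a b =
    coI m a (\<lambda>a'. tcoef v a' b) + ksign (ns_par (Igen m) * ns_par a) * coI m b (\<lambda>b'. tcoef v a b')"
  proof (rule tcoef_act_transpose)
    show "twisted_coord a (Poly_Mapping.lookup (ns_brk (Igen m) c)) =
      coI m a (\<lambda>a'. twisted_coord a' (Poly_Mapping.lookup (basis_vec c)))" for a c
      by (cases a; cases c) (auto simp: lookup_basis_vec field_simps)
    show "coI m a (\<lambda>c. f c + g c) = coI m a f + coI m a g" for a f g
      by (cases a) (simp_all add: algebra_simps)
    show "coI m a (\<lambda>c. k * f c) = k * coI m a f" for a f k
      by (cases a) (simp_all add: algebra_simps)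
  qed
  then show ?thesis by (simp add: ksign_def)
qed

lemma tcoef_act_P: "tcoef (ns_act (basis_vec (Gplus m)) v) a b =
    coP m a (\<lambda>a'. tcoef v a' b) + ksign (ns_par a) * coP m b (\<lambda>b'. tcoef v a b')"
proof -
  have "tcoef (ns_act (basis_vec (Gplus m)) v) a b =
    coP m a (\<lambda>a'. tcoef v a' b) + ksign (ns_par (Gplus m) * ns_par a) * coP m b (\<lambda>b'. tcoef v a b')"
  proof (rule tcoef_act_transpose)
    show "twisted_coord a (Poly_Mapping.lookup (ns_brk (Gplus m) c)) =
      coP m a (\<lambda>a'. twisted_coord a' (Poly_Mapping.lookup (basis_vec c)))" for a c
      by (cases a; cases c) (auto simp: lookup_basis_vec lookup_add half_idx_def field_simps)
    show "coP m a (\<lambda>c. f c + g c) = coP m a f + coP m a g" for a f g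
      by (cases a) (simp_all add: algebra_simps)
    show "coP m a (\<lambda>c. k * f c) = k * coP m a f" for a f k
      by (cases a) (simp_all add: algebra_simps)
  qed
  then show ?thesis by simp
qed

lemma tcoef_act_M: "tcoef (ns_act (basis_vec (Gminus (m - 1))) v) a b =
    coM m a (\<lambda>a'. tcoef v a' b) + ksign (ns_par a) * coM m b (\<lambda>b'. tcoef v a b')"
proof -
  have "tcoef (ns_act (basis_vec (Gminus (m - 1))) v) a b =
    coM m a (\<lambda>a'. tcoef v a' b) + ksign (ns_par (Gminus (m - 1)) * ns_par a) * coM m b (\<lambda>b'. tcoef v a b')"
  proof (rule tcoef_act_transpose)
    show "twisted_coord a (Poly_Mapping.lookup (ns_brk (Gminus (m - 1)) c)) =
      coM m a (\<lambda>a'. twisted_coord a' (Poly_Mapping.lookup (basis_vec c)))" for a c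
      by (cases a; cases c) (auto simp: lookup_basis_vec lookup_add half_idx_def field_simps)
    show "coM m a (\<lambda>c. f c + g c) = coM m a f + coM m a g" for a f g
      by (cases a) (simp_all add: algebra_simps)
    show "coM m a (\<lambda>c. k * f c) = k * coM m a f" for a f k
      by (cases a) (simp_all add: algebra_simps)
  qed
  then show ?thesis by simp
qed

section \<open>Inner derivations and the first cohomology\<close>

context lie_supermodule
begin

lemma Inn_hom_subset_Der_hom: "Inn_hom p \<subseteq> Der_hom p"
proof
  fix d assume "d \<in> Inn_hom p"
  then obtain a where lin: "Vector_Spaces.linear scale vscale d" and a: "a \<in> vgr p"
    and d: "\<And>i x. x \<in> gr i \<Longrightarrow> d x = vscale (ksign (p * i)) (act x a)"
    unfolding Inn_hom_def by auto
  have "d x \<in> vgr (i + p)" if "x \<in> gr i" for i x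
    unfolding d[OF that] by (intro V.subspace_scale V.subspace_gr act_gr that a)
  moreover have "d (bracket x y) =
      vscale (ksign (p * i)) (act x (d y)) - vscale (ksign (j * (p + i))) (act y (d x))"
    if x: "x \<in> gr i" and y: "y \<in> gr j" for i j x y
  proof -
    interpret r: Vector_Spaces.linear vscale vscale "\<lambda>v. act z v" for z by (rule act_linear_right)
    have "ksign (p * (i + j)) = ksign (p * i) * ksign (p * j)"
      "ksign (p * (i + j)) * ksign (i * j) = ksign (j * (p + i)) * ksign (p * i)"
      by (cases p; cases i; cases j; simp add: ksign_def)+
    then show ?thesis
      by (simp add: d[OF x] d[OF y] d[OF L.bracket_gr[OF x y]] act_bracket[OF x y] r.scale
          V.scale_right_diff_distrib)
  qed
  ultimately show "d \<in> Der_hom p"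
    unfolding Der_hom_def using lin by blast
qed

lemma linear_maps: "vector_space_pair scale vscale"
  by (intro vector_space_pair.intro L.vector_space_axioms V.vector_space_axioms)

lemma Der_hom_gr:
  assumes "d \<in> Der_hom p" "x \<in> gr i"
  shows "d x \<in> vgr (i + p)"
proof -
  have "\<forall>i. d ` gr i \<subseteq> vgr (i + p)"
    using assms(1) unfolding Der_hom_def mem_Collect_eq by (elim conjE)
  with assms(2) show ?thesis by blast
qed

lemma Der_hom_bracket:
  assumes "d \<in> Der_hom p" "x \<in> gr i" "y \<in> gr j"
  shows "d (bracket x y) = vscale (ksign (p * i)) (act x (d y)) - vscale (ksign (j * (p + i))) (act y (d x))"
  using assms unfolding Der_hom_def by blast

lemma Der_hom_diff: "d \<in> Der_hom p \<Longrightarrow> e \<in> Der_hom p \<Longrightarrow> (\<lambda>x. d x - e x) \<in> Der_hom p"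
proof -
  assume d: "d \<in> Der_hom p" and e: "e \<in> Der_hom p"
  interpret r: Vector_Spaces.linear vscale vscale "\<lambda>v. act z v" for z by (rule act_linear_right)
  have "Vector_Spaces.linear scale vscale (\<lambda>x. d x - e x)"
    using d e by (intro vector_space_pair.linear_compose_sub[OF linear_maps]) (simp_all add: Der_hom_def)
  moreover have "d x - e x \<in> vgr (i + p)" if "x \<in> gr i" for i x
    using d e that by (intro V.subspace_diff V.subspace_gr Der_hom_gr)
  moreover have "d (bracket x y) - e (bracket x y) =
      vscale (ksign (p * i)) (act x (d y - e y)) - vscale (ksign (j * (p + i))) (act y (d x - e x))"
    if "x \<in> gr i" "y \<in> gr j" for i j x y
    using Der_hom_bracket[OF d that] Der_hom_bracket[OF e that]
    by (simp add: r.diff V.scale_right_diff_distrib)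
  ultimately show ?thesis unfolding Der_hom_def by blast
qed

lemma Inn_hom_diff: "d \<in> Inn_hom p \<Longrightarrow> e \<in> Inn_hom p \<Longrightarrow> (\<lambda>x. d x - e x) \<in> Inn_hom p"
proof -
  assume d: "d \<in> Inn_hom p" and e: "e \<in> Inn_hom p"
  interpret r: Vector_Spaces.linear vscale vscale "\<lambda>v. act z v" for z by (rule act_linear_right)
  obtain a where a: "a \<in> vgr p" "\<And>i x. x \<in> gr i \<Longrightarrow> d x = vscale (ksign (p * i)) (act x a)"
    using d by (auto simp: Inn_hom_def)
  obtain b where b: "b \<in> vgr p" "\<And>i x. x \<in> gr i \<Longrightarrow> e x = vscale (ksign (p * i)) (act x b)"
    using e by (auto simp: Inn_hom_def)
  have "Vector_Spaces.linear scale vscale (\<lambda>x. d x - e x)"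
    using d e by (intro vector_space_pair.linear_compose_sub[OF linear_maps]) (simp_all add: Inn_hom_def)
  moreover have "a - b \<in> vgr p" using a(1) b(1) by (intro V.subspace_diff V.subspace_gr)
  moreover have "d x - e x = vscale (ksign (p * i)) (act x (a - b))" if "x \<in> gr i" for i x
    using a(2)[OF that] b(2)[OF that] by (simp add: r.diff V.scale_right_diff_distrib)
  ultimately show ?thesis unfolding Inn_hom_def by blast
qed

lemma Inn_hom_zero: "(\<lambda>x. 0) \<in> Inn_hom p"
proof -
  interpret r: Vector_Spaces.linear vscale vscale "\<lambda>v. act z v" for z by (rule act_linear_right)
  have "Vector_Spaces.linear scale vscale (\<lambda>x. 0)" by unfold_locales simp_all
  moreover have "0 \<in> vgr p" by (rule V.subspace_0) (rule V.subspace_gr)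
  ultimately show ?thesis unfolding Inn_hom_def by (auto intro!: bexI[of _ 0])
qed

lemma Inn_diff: "d \<in> Inn \<Longrightarrow> e \<in> Inn \<Longrightarrow> (\<lambda>x. d x - e x) \<in> Inn"
proof -
  assume "d \<in> Inn" "e \<in> Inn"
  then obtain d0 d1 e0 e1 where *: "d0 \<in> Inn_hom 0" "d1 \<in> Inn_hom 1" "e0 \<in> Inn_hom 0" "e1 \<in> Inn_hom 1"
    "d = (\<lambda>x. d0 x + d1 x)" "e = (\<lambda>x. e0 x + e1 x)"
    unfolding Inn_def by blast
  have "(\<lambda>x. d x - e x) = (\<lambda>x. (d0 x - e0 x) + (d1 x - e1 x))"
    unfolding *(5,6) by (rule ext) simp
  moreover have "(\<lambda>x. d0 x - e0 x) \<in> Inn_hom 0" "(\<lambda>x. d1 x - e1 x) \<in> Inn_hom 1"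
    by (intro Inn_hom_diff *)+
  ultimately show ?thesis
    unfolding Inn_def by (intro CollectI exI conjI)
qed

lemma zero_in_Inn: "(\<lambda>x. 0) \<in> Inn"
  unfolding Inn_def using Inn_hom_zero[of 0] Inn_hom_zero[of 1] by force

lemma Der_eq_InnI:
  assumes "\<And>p d. d \<in> Der_hom p \<Longrightarrow> d \<in> Inn_hom p"
  shows "Der = Inn"
proof -
  have "Der_hom p = Inn_hom p" for p using assms Inn_hom_subset_Der_hom by blast
  then show ?thesis by (simp add: Der_def Inn_def)
qed

text \<open>If every derivation is inner, all of them lie in one coset, that of the zero map.\<close>

lemma H1_eq_singleton: "Der = Inn \<Longrightarrow> H1 = {Inn}"
proof -
  assume eq: "Der = Inn"
  let ?r = "{(d, e). d \<in> Der \<and> e \<in> Der \<and> (\<lambda>x. d x - e x) \<in> Inn}"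
  have "?r `` {d} = Inn" if "d \<in> Inn" for d
    using that Inn_diff by (auto simp: eq)
  moreover have "Inn \<noteq> {}" using zero_in_Inn by blast
  ultimately show ?thesis unfolding H1_def quotient_def eq by auto
qed

end

text \<open>\<open>Inn_hom\<close> speaks of a linear map with prescribed values on homogeneous vectors; this is that map.\<close>

definition inn :: "bit \<Rightarrow> ns_tensor \<Rightarrow> ns \<Rightarrow> ns_tensor" where
  "inn p u = lin_ext fscale (\<lambda>a. fscale (ksign (p * ns_par a)) (ns_act (basis_vec a) u))"

lemma inn_basis_vec: "inn p u (basis_vec a) = fscale (ksign (p * ns_par a)) (ns_act (basis_vec a) u)"
  by (simp add: inn_def vector_space_fscale)

lemma inn_in_Inn_hom:
  assumes "u \<in> ns_tensor_gr p"
  shows "inn p u \<in> NS.Inn_hom p"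
proof -
  have lin: "Vector_Spaces.linear fscale fscale (inn p u)"
    unfolding inn_def by (rule linear_lin_ext) (rule vector_space_fscale)
  moreover have "inn p u x = fscale (ksign (p * i)) (ns_act x u)" if "x \<in> ns_gr i" for i x
  proof (rule linear_eqI_basis[OF lin])
    show "Vector_Spaces.linear fscale fscale (\<lambda>x. fscale (ksign (p * i)) (ns_act x u))"
      by unfold_locales (simp_all add: ns_lin mult.commute)
    show "inn p u (basis_vec a) = fscale (ksign (p * i)) (ns_act (basis_vec a) u)"
      if "a \<in> Poly_Mapping.keys x" for a
      using that \<open>x \<in> ns_gr i\<close> by (auto simp: inn_basis_vec fgr_def)
  qed
  ultimately show ?thesis unfolding NS.Inn_hom_def using assms by blast
qed

lemma Der_hom_basis:
  assumes "d \<in> NS.Der_hom p"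
  shows "d (ns_brk x y) = fscale (ksign (p * ns_par x)) (ns_act (basis_vec x) (d (basis_vec y)))
    - fscale (ksign (ns_par y * (p + ns_par x))) (ns_act (basis_vec y) (d (basis_vec x)))"
proof -
  have "basis_vec x \<in> ns_gr (ns_par x)" "basis_vec y \<in> ns_gr (ns_par y)" by (simp_all add: fgr_basis)
  then show ?thesis using NS.Der_hom_bracket[OF assms] by (metis ns_bracket_basis)
qed

lemma Der_hom_linear: "d \<in> NS.Der_hom p \<Longrightarrow> Vector_Spaces.linear fscale fscale d"
  by (simp add: NS.Der_hom_def)

lemma Der_hom_basis_gr: "d \<in> NS.Der_hom p \<Longrightarrow> d (basis_vec x) \<in> ns_tensor_gr (ns_par x + p)"
  by (rule NS.Der_hom_gr) (simp_all add: fgr_basis)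

lemma linear_zeroI_basis:
  assumes "Vector_Spaces.linear fscale fscale d" "\<And>a. d (basis_vec a) = 0"
  shows "d = (\<lambda>x. 0)"
proof
  show "d x = 0" for x
    using linear_eq_lin_ext[OF assms(1), of x] by (simp add: lin_ext_def assms(2))
qed

section \<open>The charge grading\<close>

text \<open>The eigenvalue of \<open>I\<^sub>0\<close> under the adjoint action.\<close>

fun charge :: "ns_basis \<Rightarrow> int" where
  "charge (Lgen i) = 0"
| "charge (Igen i) = 0"
| "charge (Gplus i) = 1"
| "charge (Gminus i) = -1"

lemma tcoef_act_I0:
  "tcoef (ns_act (basis_vec (Igen 0)) v) a b = of_int (charge a + charge b) * tcoef v a b"
  by (cases a; cases b) (simp_all add: tcoef_act_I)

lemma ns_brk_I0: "ns_brk (Igen 0) x = fscale (of_int (charge x)) (basis_vec x)"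
  by (cases x) (auto intro!: poly_mapping_eqI)

definition has_charge :: "int \<Rightarrow> ns_tensor \<Rightarrow> bool" where
  "has_charge q v \<longleftrightarrow> (\<forall>a b. charge a + charge b \<noteq> q \<longrightarrow> tcoef v a b = 0)"

lemma has_charge_iff: "has_charge q v \<longleftrightarrow> ns_act (basis_vec (Igen 0)) v = fscale (of_int q) v"
  (is "_ \<longleftrightarrow> ?w = _")
proof
  assume "has_charge q v"
  then show "?w = fscale (of_int q) v"
    by (intro tensor_eqI_tcoef) (metis has_charge_def mult_zero_right tcoef_act_I0 tcoef_scale)
next
  assume "?w = fscale (of_int q) v"
  then have "of_int (charge a + charge b) * tcoef v a b = of_int q * tcoef v a b" for a b
    by (metis tcoef_act_I0 tcoef_scale)
  then show "has_charge q v" unfolding has_charge_def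
    by (metis mult_cancel_right of_int_eq_iff)
qed

lemma even_if_charge_zero: "has_charge 0 v \<Longrightarrow> v \<in> ns_tensor_gr 0"
  unfolding tcoef_gr_iff has_charge_def
proof (intro allI impI)
  fix a b assume "\<forall>a b. charge a + charge b \<noteq> 0 \<longrightarrow> tcoef v a b = 0" "ns_par a + ns_par b \<noteq> 0"
  then show "tcoef v a b = 0" by (cases a; cases b) auto
qed

lemma Der_hom_has_charge:
  assumes d: "d \<in> NS.Der_hom p" and I0: "d (basis_vec (Igen 0)) = 0"
  shows "has_charge (charge x) (d (basis_vec x))"
proof -
  interpret d: Vector_Spaces.linear fscale fscale d by (rule Der_hom_linear) fact
  have "d (fscale (of_int (charge x)) (basis_vec x)) = ns_act (basis_vec (Igen 0)) (d (basis_vec x))"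
    using Der_hom_basis[OF d, of "Igen 0" x] by (simp add: I0 ns_brk_I0 ksign_def)
  then show ?thesis by (simp add: has_charge_iff d.scale)
qed

lemma charge_act:
  assumes "has_charge q v" shows "has_charge (charge x + q) (ns_act (basis_vec x) v)"
proof -
  have "ns_act (ns_bracket (basis_vec (Igen 0)) (basis_vec x)) v =
      ns_act (basis_vec (Igen 0)) (ns_act (basis_vec x) v)
      - fscale (ksign (0 * ns_par x)) (ns_act (basis_vec x) (ns_act (basis_vec (Igen 0)) v))"
    by (rule ns_act_bracket) (simp_all add: fgr_basis)
  then show ?thesis using assms
    by (simp add: has_charge_iff ns_brk_I0 ns_lin ksign_def)
qed

section \<open>Two-variable Laurent polynomials as finitely supported functions\<close>

definition fin_supp :: "('a \<Rightarrow> 'b \<Rightarrow> complex) \<Rightarrow> bool" where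
  "fin_supp F \<longleftrightarrow> finite {(i, j). F i j \<noteq> 0}"

lemma fin_supp_reindex:
  assumes "fin_supp F" "inj f" "inj g"
  shows "fin_supp (\<lambda>i j. F (f i) (g j))"
proof -
  have "finite ((\<lambda>(i, j). (f i, g j)) -` {(i, j). F i j \<noteq> 0})"
    using assms by (intro finite_vimageI) (auto simp: fin_supp_def inj_on_def)
  then show ?thesis by (simp add: fin_supp_def vimage_def case_prod_unfold)
qed

lemma fin_supp_tcoef: "inj f \<Longrightarrow> inj g \<Longrightarrow> fin_supp (\<lambda>i j. tcoef v (f i) (g j))"
  by (rule fin_supp_reindex) (simp_all add: fin_supp_def finite_tcoef_support)

lemma fin_supp_zero: "fin_supp (\<lambda>i j. 0)"
  by (simp add: fin_supp_def)

lemma fin_supp_add: "fin_supp F \<Longrightarrow> fin_supp G \<Longrightarrow> fin_supp (\<lambda>i j. F i j + G i j)"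
  unfolding fin_supp_def
  by (rule finite_subset[of _ "{(i, j). F i j \<noteq> 0} \<union> {(i, j). G i j \<noteq> 0}"]) auto

lemma fin_supp_scale: "fin_supp F \<Longrightarrow> fin_supp (\<lambda>i j. c * F i j)"
  unfolding fin_supp_def by (rule finite_subset[of _ "{(i, j). F i j \<noteq> 0}"]) auto

lemma fin_supp_divide: "fin_supp F \<Longrightarrow> fin_supp (\<lambda>i j. F i j / c)"
  using fin_supp_scale[of F "1 / c"] by simp

lemma fin_supp_uminus: "fin_supp F \<Longrightarrow> fin_supp (\<lambda>i j. - F i j)"
  by (simp add: fin_supp_def)

lemma fin_supp_diff: "fin_supp F \<Longrightarrow> fin_supp G \<Longrightarrow> fin_supp (\<lambda>i j. F i j - G i j)"
  using fin_supp_add[of F "\<lambda>i j. - G i j"] fin_supp_uminus[of G] by simp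

lemmas fin_supp_intros = fin_supp_tcoef fin_supp_zero fin_supp_add fin_supp_scale fin_supp_divide
  fin_supp_uminus fin_supp_diff

text \<open>This is the cancellation of \<open>x - y\<close>: if \<open>(x - y) F = 0\<close>, then \<open>F\<close> is constant along the lines
  \<open>i + j = const\<close>, which a nonzero function of finite support cannot be.\<close>

lemma diagonal_cancel:
  fixes F :: "int \<Rightarrow> int \<Rightarrow> complex"
  assumes fin: "fin_supp F" and eq: "\<And>i j. F (i - 1) j = F i (j - 1)"
  shows "F i j = 0"
proof (rule ccontr)
  assume ne: "F i j \<noteq> 0"
  have "F (i + int n) (j - int n) = F i j" for n
  proof (induction n)
    case (Suc n)
    show ?case using eq[of "i + int (Suc n)" "j - int n"] Suc by (simp add: algebra_simps)
  qed simp
  then have "range (\<lambda>n. (i + int n, j - int n)) \<subseteq> {(i, j). F i j \<noteq> 0}" using ne by auto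
  moreover have "infinite (range (\<lambda>n. (i + int n, j - int n)))"
    by (subst finite_image_iff) (auto simp: inj_on_def)
  ultimately show False using fin by (auto simp: fin_supp_def dest: finite_subset)
qed

text \<open>The only pairs of letters of charge zero are \<open>LL\<close>, \<open>LI\<close>, \<open>IL\<close>, \<open>II\<close>, \<open>PM\<close> and \<open>MP\<close>, so an
  element of charge zero amounts to six Laurent polynomials.\<close>

lemma charge_zero_tensor:
  fixes \<alpha> \<beta> \<gamma> \<epsilon> g h :: "int \<Rightarrow> int \<Rightarrow> complex"
  assumes "fin_supp \<alpha>" "fin_supp \<beta>" "fin_supp \<gamma>" "fin_supp \<epsilon>" "fin_supp g" "fin_supp h"
  obtains u where "has_charge 0 u"
    "\<And>i j. tcoef u (Lgen i) (Lgen j) = \<alpha> i j" "\<And>i j. tcoef u (Lgen i) (Igen j) = \<beta> i j"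
    "\<And>i j. tcoef u (Igen i) (Lgen j) = \<gamma> i j" "\<And>i j. tcoef u (Igen i) (Igen j) = \<epsilon> i j"
    "\<And>i j. tcoef u (Gplus i) (Gminus j) = g i j" "\<And>i j. tcoef u (Gminus i) (Gplus j) = h i j"
proof -
  define F where "F a b = (case (a, b) of (Lgen i, Lgen j) \<Rightarrow> \<alpha> i j | (Lgen i, Igen j) \<Rightarrow> \<beta> i j
    | (Igen i, Lgen j) \<Rightarrow> \<gamma> i j | (Igen i, Igen j) \<Rightarrow> \<epsilon> i j
    | (Gplus i, Gminus j) \<Rightarrow> g i j | (Gminus i, Gplus j) \<Rightarrow> h i j | _ \<Rightarrow> 0)" for a b
  have "{(a, b). F a b \<noteq> 0} \<subseteq>
      map_prod Lgen Lgen ` {(i, j). \<alpha> i j \<noteq> 0} \<union> map_prod Lgen Igen ` {(i, j). \<beta> i j \<noteq> 0}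
    \<union> map_prod Igen Lgen ` {(i, j). \<gamma> i j \<noteq> 0} \<union> map_prod Igen Igen ` {(i, j). \<epsilon> i j \<noteq> 0}
    \<union> map_prod Gplus Gminus ` {(i, j). g i j \<noteq> 0} \<union> map_prod Gminus Gplus ` {(i, j). h i j \<noteq> 0}"
  proof clarify
    fix a b assume "F a b \<noteq> 0" "(a, b) \<notin> map_prod Gminus Gplus ` {(i, j). h i j \<noteq> 0}"
      "(a, b) \<notin> map_prod Gplus Gminus ` {(i, j). g i j \<noteq> 0}"
      "(a, b) \<notin> map_prod Igen Igen ` {(i, j). \<epsilon> i j \<noteq> 0}"
      "(a, b) \<notin> map_prod Igen Lgen ` {(i, j). \<gamma> i j \<noteq> 0}"
      "(a, b) \<notin> map_prod Lgen Igen ` {(i, j). \<beta> i j \<noteq> 0}"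
    then show "(a, b) \<in> map_prod Lgen Lgen ` {(i, j). \<alpha> i j \<noteq> 0}"
      by (cases a; cases b) (auto simp: F_def image_iff)
  qed
  then have "finite {(a, b). F a b \<noteq> 0}"
    by (rule finite_subset) (use assms in \<open>auto simp: fin_supp_def\<close>)
  then obtain u where u: "\<And>a b. tcoef u a b = F a b" by (rule tcoef_surj) blast
  have "F a b = 0" if "charge a + charge b \<noteq> 0" for a b
    using that by (cases a; cases b) (simp_all add: F_def)
  then have "has_charge 0 u" by (simp add: has_charge_def u)
  then show thesis by (rule that) (simp_all add: u F_def)
qed

lemma charge_zero_eqI:
  assumes "has_charge 0 u" "has_charge 0 v"
    "\<And>i j. tcoef u (Lgen i) (Lgen j) = tcoef v (Lgen i) (Lgen j)"
    "\<And>i j. tcoef u (Lgen i) (Igen j) = tcoef v (Lgen i) (Igen j)"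
    "\<And>i j. tcoef u (Igen i) (Lgen j) = tcoef v (Igen i) (Lgen j)"
    "\<And>i j. tcoef u (Igen i) (Igen j) = tcoef v (Igen i) (Igen j)"
    "\<And>i j. tcoef u (Gplus i) (Gminus j) = tcoef v (Gplus i) (Gminus j)"
    "\<And>i j. tcoef u (Gminus i) (Gplus j) = tcoef v (Gminus i) (Gplus j)"
  shows "u = v"
proof (rule tensor_eqI_tcoef)
  show "tcoef u a b = tcoef v a b" for a b
    by (cases a; cases b) (use assms in \<open>auto simp: has_charge_def\<close>)
qed

lemma charge_one_eqI:
  assumes "has_charge 1 u" "has_charge 1 v"
    "\<And>i j. tcoef u (Lgen i) (Gplus j) = tcoef v (Lgen i) (Gplus j)"
    "\<And>i j. tcoef u (Igen i) (Gplus j) = tcoef v (Igen i) (Gplus j)"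
    "\<And>i j. tcoef u (Gplus i) (Lgen j) = tcoef v (Gplus i) (Lgen j)"
    "\<And>i j. tcoef u (Gplus i) (Igen j) = tcoef v (Gplus i) (Igen j)"
  shows "u = v"
proof (rule tensor_eqI_tcoef)
  show "tcoef u a b = tcoef v a b" for a b
    by (cases a; cases b) (use assms in \<open>auto simp: has_charge_def\<close>)
qed

lemma charge_minus_one_eqI:
  assumes "has_charge (-1) u" "has_charge (-1) v"
    "\<And>i j. tcoef u (Lgen i) (Gminus j) = tcoef v (Lgen i) (Gminus j)"
    "\<And>i j. tcoef u (Igen i) (Gminus j) = tcoef v (Igen i) (Gminus j)"
    "\<And>i j. tcoef u (Gminus i) (Lgen j) = tcoef v (Gminus i) (Lgen j)"
    "\<And>i j. tcoef u (Gminus i) (Igen j) = tcoef v (Gminus i) (Igen j)"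
  shows "u = v"
proof (rule tensor_eqI_tcoef)
  show "tcoef u a b = tcoef v a b" for a b
    by (cases a; cases b) (use assms in \<open>auto simp: has_charge_def\<close>)
qed

section \<open>Derivations killing the charge operator\<close>

lemma eq_tcoef: "u = v \<Longrightarrow> tcoef u a b = tcoef v a b"
  by simp

lemmas act_simps = tcoef_act_I tcoef_act_P tcoef_act_M[of 0, simplified] tcoef_act_M[of 1, simplified] ksign_def

text \<open>\<open>I\<^sub>1\<close> multiplies the \<open>LL\<close> component by \<open>x\<close>, contributing it to \<open>IL\<close>, and the \<open>PM\<close> and
  \<open>MP\<close> components by \<open>\<plusminus>(x - y)\<close>.  With these gone, \<open>P\<^sub>0\<close> recovers the other three up to sign.\<close>

lemma charge_zero_invariant_eq_zero:
  assumes w: "has_charge 0 w" and I: "ns_act (basis_vec (Igen 1)) w = 0"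
    and P: "ns_act (basis_vec (Gplus 0)) w = 0"
  shows "w = 0"
proof -
  note I' = eq_tcoef[OF I] and P' = eq_tcoef[OF P]
  have LL: "tcoef w (Lgen i) (Lgen j) = 0" for i j
    using I'[of "Igen (i + 1)" "Lgen j"] by (simp add: act_simps)
  have PM: "tcoef w (Gplus i) (Gminus j) = 0" for i j
  proof (rule diagonal_cancel)
    show "tcoef w (Gplus (i - 1)) (Gminus j) = tcoef w (Gplus i) (Gminus (j - 1))" for i j
      using I'[of "Gplus i" "Gminus j"] by (simp add: act_simps)
  qed (intro fin_supp_intros injI; simp)
  have MP: "tcoef w (Gminus i) (Gplus j) = 0" for i j
  proof (rule diagonal_cancel)
    show "tcoef w (Gminus (i - 1)) (Gplus j) = tcoef w (Gminus i) (Gplus (j - 1))" for i j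
      using I'[of "Gminus i" "Gplus j"] by (simp add: act_simps)
  qed (intro fin_supp_intros injI; simp)
  have LI: "tcoef w (Lgen i) (Igen j) = 0" for i j
    using P'[of "Lgen i" "Gplus j"] by (simp add: act_simps MP)
  have IL: "tcoef w (Igen i) (Lgen j) = 0" for i j
    using P'[of "Gplus i" "Lgen j"] by (simp add: act_simps PM)
  have II: "tcoef w (Igen i) (Igen j) = 0" for i j
    using P'[of "Igen i" "Gplus j"] by (simp add: act_simps)
  show ?thesis
    by (rule charge_zero_eqI[OF w]) (simp_all add: has_charge_def LL LI IL II PM MP)
qed

text \<open>Dividing by the charge yields \<open>u\<close> such that \<open>w = d(I\<^sub>0) - I\<^sub>0 * u\<close> has charge zero.  For \<open>x\<close> of
  charge \<open>q\<close> the vector \<open>x * w\<close> has charge \<open>q\<close>.  Up to sign it equals \<open>I\<^sub>0 * d'(x) - q d'(x)\<close>, where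
  \<open>d'\<close> is the reduced derivation, and in that difference the part of charge \<open>q\<close> cancels.  Hence \<open>w\<close>
  is invariant.\<close>

lemma Der_hom_reduce_I0:
  assumes d: "d \<in> NS.Der_hom p"
  obtains u where "u \<in> ns_tensor_gr p" "d (basis_vec (Igen 0)) = inn p u (basis_vec (Igen 0))"
proof -
  let ?v = "d (basis_vec (Igen 0))"
  define F where "F a b = (if charge a + charge b = 0 then 0 else tcoef ?v a b / of_int (charge a + charge b))" for a b
  have "{(a, b). F a b \<noteq> 0} \<subseteq> {(a, b). tcoef ?v a b \<noteq> 0}" by (auto simp: F_def split: if_splits)
  then have "finite {(a, b). F a b \<noteq> 0}" by (rule finite_subset) (rule finite_tcoef_support)
  then obtain u where u: "\<And>a b. tcoef u a b = F a b" by (rule tcoef_surj) blast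
  have "?v \<in> ns_tensor_gr p" using Der_hom_basis_gr[OF d, of "Igen 0"] by (simp only: ns_par.simps add_0)
  then have gr: "u \<in> ns_tensor_gr p" by (auto simp: tcoef_gr_iff u F_def)
  define d' where "d' = (\<lambda>x. d x - inn p u x)"
  have d': "d' \<in> NS.Der_hom p" unfolding d'_def
    using NS.Der_hom_diff[OF d] inn_in_Inn_hom[OF gr] NS.Inn_hom_subset_Der_hom by blast
  interpret d': Vector_Spaces.linear fscale fscale d' by (rule Der_hom_linear) fact
  define w where "w = d' (basis_vec (Igen 0))"
  have w: "has_charge 0 w"
    unfolding has_charge_def w_def d'_def inn_basis_vec tcoef_diff tcoef_scale tcoef_act_I0 u F_def
    by (simp add: ksign_def del: of_int_add)
  have kill: "ns_act (basis_vec x) w = 0" for x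
  proof (rule tensor_eqI_tcoef)
    fix a b
    have "fscale (of_int (charge x)) (d' (basis_vec x)) =
        ns_act (basis_vec (Igen 0)) (d' (basis_vec x)) - fscale (ksign (ns_par x * p)) (ns_act (basis_vec x) w)"
      using Der_hom_basis[OF d', of "Igen 0" x] by (simp add: ns_brk_I0 d'.scale ksign_def w_def)
    then have "of_int (charge x) * tcoef (d' (basis_vec x)) a b =
        of_int (charge a + charge b) * tcoef (d' (basis_vec x)) a b
        - ksign (ns_par x * p) * tcoef (ns_act (basis_vec x) w) a b"
      by (metis tcoef_act_I0 tcoef_diff tcoef_scale)
    moreover have "charge a + charge b \<noteq> charge x \<Longrightarrow> tcoef (ns_act (basis_vec x) w) a b = 0"
      using charge_act[OF w, of x] by (simp add: has_charge_def)
    ultimately show "tcoef (ns_act (basis_vec x) w) a b = tcoef 0 a b"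
      by (cases "charge a + charge b = charge x") (auto simp: ksign_def split: if_splits)
  qed
  have "w = 0" by (rule charge_zero_invariant_eq_zero[OF w kill kill])
  then show thesis using that[OF gr] by (simp add: w_def d'_def)
qed

text \<open>\<open>d(x)\<close> has the charge of \<open>x\<close>, hence its parity; as \<open>d\<close> is odd, it also has the opposite parity.\<close>

lemma odd_Der_hom_zero:
  assumes d: "d \<in> NS.Der_hom 1" and I0: "d (basis_vec (Igen 0)) = 0"
  shows "d = (\<lambda>x. 0)"
proof (rule linear_zeroI_basis[OF Der_hom_linear[OF d]])
  fix x
  have c: "has_charge (charge x) (d (basis_vec x))" by (rule Der_hom_has_charge) fact+
  have g: "d (basis_vec x) \<in> ns_tensor_gr (ns_par x + 1)" by (rule Der_hom_basis_gr[OF d])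
  show "d (basis_vec x) = 0"
  proof (rule tensor_eqI_tcoef)
    fix a b
    have "charge a + charge b = charge x \<Longrightarrow> ns_par a + ns_par b \<noteq> ns_par x + 1"
      by (cases a; cases b; cases x) simp_all
    then show "tcoef (d (basis_vec x)) a b = tcoef 0 a b"
      using c g by (auto simp: has_charge_def tcoef_gr_iff)
  qed
qed

section \<open>Even derivations\<close>

lemma even_Der_hom_basis:
  assumes "d \<in> NS.Der_hom 0"
  shows "d (ns_brk x y) = ns_act (basis_vec x) (d (basis_vec y))
    - fscale (ksign (ns_par y * ns_par x)) (ns_act (basis_vec y) (d (basis_vec x)))"
  using Der_hom_basis[OF assms, of x y] by (simp add: ksign_def)

text \<open>The even derivations that are left after the first reduction; they preserve the charge.\<close>

locale even_cocycle =
  fixes d assumes der: "d \<in> NS.Der_hom 0" and d_I0: "d (basis_vec (Igen 0)) = 0"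
begin

sublocale d: Vector_Spaces.linear fscale fscale d
  by (rule Der_hom_linear) (rule der)

lemma charge_of_value: "has_charge (charge x) (d (basis_vec x))"
  by (rule Der_hom_has_charge) (rule der d_I0)+

lemma subtract_inner:
  assumes "has_charge 0 u" shows "even_cocycle (\<lambda>x. d x - inn 0 u x)"
proof
  have "inn 0 u \<in> NS.Der_hom 0"
    using inn_in_Inn_hom[OF even_if_charge_zero[OF assms]] NS.Inn_hom_subset_Der_hom by blast
  then show "(\<lambda>x. d x - inn 0 u x) \<in> NS.Der_hom 0" by (rule NS.Der_hom_diff[OF der])
  show "d (basis_vec (Igen 0)) - inn 0 u (basis_vec (Igen 0)) = 0"
    using assms by (simp add: d_I0 inn_basis_vec ksign_def has_charge_iff)
qed

text \<open>Let \<open>k\<close> be the linear map with \<open>P\<^sub>i \<mapsto> - I\<^sub>i\<close> and \<open>L'\<^sub>i \<mapsto> M\<^sub>i / 2\<close> that kills \<open>I\<^sub>i\<close> and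
  \<open>M\<^sub>i\<close>.  It is a contracting homotopy for \<open>P\<^sub>0\<close> on the algebra, and \<open>k \<otimes> 1\<close> is one on the tensor
  square.  So \<open>u\<close> is obtained by applying \<open>k \<otimes> 1\<close> to the \<open>P\<^sub>0\<close>-closed element \<open>d(P\<^sub>0)\<close>.\<close>

lemma P0_exact:
  obtains u where "has_charge 0 u" "d (basis_vec (Gplus 0)) = ns_act (basis_vec (Gplus 0)) u"
proof -
  let ?w = "d (basis_vec (Gplus 0))"
  have "d (ns_brk (Gplus 0) (Gplus 0)) = fscale 2 (ns_act (basis_vec (Gplus 0)) ?w)"
    unfolding even_Der_hom_basis[OF der]
    by (intro poly_mapping_eqI) (simp add: ksign_def lookup_minus lookup_add)
  then have closed: "ns_act (basis_vec (Gplus 0)) ?w = 0" by (simp add: d.zero)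
  obtain u where u: "has_charge 0 u"
    "\<And>i j. tcoef u (Lgen i) (Lgen j) = 0" "\<And>i j. tcoef u (Lgen i) (Igen j) = 0"
    "\<And>i j. tcoef u (Igen i) (Lgen j) = - tcoef ?w (Gplus i) (Lgen j)"
    "\<And>i j. tcoef u (Igen i) (Igen j) = - tcoef ?w (Gplus i) (Igen j)"
    "\<And>i j. tcoef u (Gplus i) (Gminus j) = 0"
    "\<And>i j. tcoef u (Gminus i) (Gplus j) = tcoef ?w (Lgen i) (Gplus j) / 2"
    by (rule charge_zero_tensor[of "\<lambda>i j. 0" "\<lambda>i j. 0" "\<lambda>i j. - tcoef ?w (Gplus i) (Lgen j)"
          "\<lambda>i j. - tcoef ?w (Gplus i) (Igen j)" "\<lambda>i j. 0" "\<lambda>i j. tcoef ?w (Lgen i) (Gplus j) / 2"])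
      (auto intro!: fin_supp_intros injI)
  have "?w = ns_act (basis_vec (Gplus 0)) u"
  proof (rule charge_one_eqI)
    show "has_charge 1 ?w" using charge_of_value[of "Gplus 0"] by simp
    show "has_charge 1 (ns_act (basis_vec (Gplus 0)) u)" using charge_act[OF u(1), of "Gplus 0"] by simp
    show "tcoef ?w (Igen i) (Gplus j) = tcoef (ns_act (basis_vec (Gplus 0)) u) (Igen i) (Gplus j)" for i j
      using eq_tcoef[OF closed, of "Gplus i" "Gplus j"] by (simp add: act_simps u)
  qed (simp_all add: act_simps u)
  with u(1) show thesis by (rule that)
qed

end

text \<open>What is left after the second reduction.  Such a \<open>d\<close> is determined on \<open>P\<^sub>n\<close> by its values on the
  \<open>I\<^sub>n\<close> (\<open>d_P\<close>), so the unknowns are Laurent polynomials of charge zero and the value at \<open>M\<^sub>0\<close>.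
  Below, letters name the components of \<open>d(I\<^sub>1)\<close>: \<open>b\<close> for \<open>LI\<close>, \<open>c\<close> for \<open>IL\<close>, \<open>e\<close> for
  \<open>II\<close>, \<open>g\<close> for \<open>PM\<close> and \<open>h\<close> for \<open>MP\<close>.  The coefficients of \<open>x F\<close> and \<open>y F\<close> at
  \<open>(i, j)\<close> are \<open>F (i - 1) j\<close> and \<open>F i (j - 1)\<close>.\<close>

locale reduced_cocycle = even_cocycle +
  assumes d_P0: "d (basis_vec (Gplus 0)) = 0"
begin

lemma subtract_inner_reduced:
  assumes "has_charge 0 u" "ns_act (basis_vec (Gplus 0)) u = 0"
  shows "reduced_cocycle (\<lambda>x. d x - inn 0 u x)"
  by (intro reduced_cocycle.intro reduced_cocycle_axioms.intro subtract_inner assms)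
    (simp add: d_P0 inn_basis_vec assms)

lemma I_I: "ns_act (basis_vec (Igen m)) (d (basis_vec (Igen n))) = ns_act (basis_vec (Igen n)) (d (basis_vec (Igen m)))"
  using even_Der_hom_basis[OF der, of "Igen m" "Igen n"] by (simp add: d.zero ksign_def)

lemma I_P: "d (basis_vec (Gplus (m + n))) =
   ns_act (basis_vec (Igen m)) (d (basis_vec (Gplus n))) - ns_act (basis_vec (Gplus n)) (d (basis_vec (Igen m)))"
  using even_Der_hom_basis[OF der, of "Igen m" "Gplus n"] by (simp add: ksign_def)

lemma d_P: "d (basis_vec (Gplus n)) = - ns_act (basis_vec (Gplus 0)) (d (basis_vec (Igen n)))"
  using I_P[of n 0] by (simp add: d_P0)

lemma I_M: "d (basis_vec (Gminus (m + n - 1))) =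
   ns_act (basis_vec (Gminus (n - 1))) (d (basis_vec (Igen m))) - ns_act (basis_vec (Igen m)) (d (basis_vec (Gminus (n - 1))))"
  using even_Der_hom_basis[OF der, of "Igen m" "Gminus (n - 1)"]
  by (simp add: ksign_def d.neg algebra_simps)

text \<open>The image under \<open>d\<close> of \<open>[I\<^sub>1, P\<^sub>1] = P\<^sub>2\<close>, with \<open>d(P\<^sub>n)\<close> eliminated.\<close>

lemma relation_IP: "ns_act (basis_vec (Igen 1)) (ns_act (basis_vec (Gplus 0)) (d (basis_vec (Igen 1))))
   + ns_act (basis_vec (Gplus 1)) (d (basis_vec (Igen 1)))
   = ns_act (basis_vec (Gplus 0)) (d (basis_vec (Igen 2)))"
  using I_P[of 1 1] by (simp add: d_P ns_lin algebra_simps)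

text \<open>The image under \<open>d\<close> of \<open>[I\<^sub>1, M\<^sub>1] = [I\<^sub>2, M\<^sub>0]\<close>, with \<open>d(M\<^sub>1)\<close> expressed through \<open>d(M\<^sub>0)\<close>.\<close>

lemma relation_IM:
  "ns_act (basis_vec (Igen 1)) (ns_act (basis_vec (Gminus (-1))) (d (basis_vec (Igen 1)))
     - ns_act (basis_vec (Igen 1)) (d (basis_vec (Gminus (-1)))))
   = ns_act (basis_vec (Gminus 0)) (d (basis_vec (Igen 1)))
    + ns_act (basis_vec (Igen 2)) (d (basis_vec (Gminus (-1))))
    - ns_act (basis_vec (Gminus (-1))) (d (basis_vec (Igen 2)))"
proof -
  have M1: "d (basis_vec (Gminus 0)) = ns_act (basis_vec (Gminus (-1))) (d (basis_vec (Igen 1)))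
      - ns_act (basis_vec (Igen 1)) (d (basis_vec (Gminus (-1))))"
    using I_M[of 1 0] by simp
  have "ns_act (basis_vec (Gminus 0)) (d (basis_vec (Igen 1)))
      - ns_act (basis_vec (Igen 1)) (d (basis_vec (Gminus 0)))
    = ns_act (basis_vec (Gminus (-1))) (d (basis_vec (Igen 2)))
      - ns_act (basis_vec (Igen 2)) (d (basis_vec (Gminus (-1))))"
    using I_M[of 1 1] I_M[of 2 0] by simp
  then show ?thesis unfolding M1 by (simp add: algebra_simps)
qed

text \<open>Applying \<open>I\<^sub>1\<close> to \<open>d(I\<^sub>2)\<close> and \<open>I\<^sub>2\<close> to \<open>d(I\<^sub>1)\<close> gives the same, so that the \<open>LL\<close> component of
  \<open>d(I\<^sub>2)\<close> is both \<open>2x\<close> and \<open>2y\<close> times that of \<open>d(I\<^sub>1)\<close>.\<close>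

lemma I1_LL: "tcoef (d (basis_vec (Igen 1))) (Lgen i) (Lgen j) = 0"
proof -
  let ?f = "d (basis_vec (Igen 1))" and ?f2 = "d (basis_vec (Igen 2))"
  note E = eq_tcoef[OF I_I[of 1 2]]
  show ?thesis
  proof (rule diagonal_cancel[where F = "\<lambda>i j. tcoef ?f (Lgen i) (Lgen j)"])
    fix i j
    have "tcoef ?f2 (Lgen i) (Lgen j) = 2 * tcoef ?f (Lgen i) (Lgen (j - 1))"
      using E[of "Lgen i" "Igen (j + 1)"] by (simp add: act_simps)
    moreover have "tcoef ?f2 (Lgen i) (Lgen j) = 2 * tcoef ?f (Lgen (i - 1)) (Lgen j)"
      using E[of "Igen (i + 1)" "Lgen j"] by (simp add: act_simps)
    ultimately show "tcoef ?f (Lgen (i - 1)) (Lgen j) = tcoef ?f (Lgen i) (Lgen (j - 1))" by simp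
  qed (intro fin_supp_intros injI; simp)
qed

text \<open>\<open>(x - y)\<close> times the component of \<open>d(I\<^sub>2)\<close> is \<open>x\<^sup>2 - y\<^sup>2\<close> times that of \<open>d(I\<^sub>1)\<close>.\<close>

lemma I2_PM: "tcoef (d (basis_vec (Igen 2))) (Gplus i) (Gminus j) =
    tcoef (d (basis_vec (Igen 1))) (Gplus (i - 1)) (Gminus j) + tcoef (d (basis_vec (Igen 1))) (Gplus i) (Gminus (j - 1))"
proof -
  let ?f = "d (basis_vec (Igen 1))" and ?f2 = "d (basis_vec (Igen 2))"
  let ?F = "\<lambda>i j. tcoef ?f2 (Gplus i) (Gminus j)
    - (tcoef ?f (Gplus (i - 1)) (Gminus j) + tcoef ?f (Gplus i) (Gminus (j - 1)))"
  have "?F i j = 0"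
  proof (rule diagonal_cancel[where F = ?F])
    show "?F (i - 1) j = ?F i (j - 1)" for i j
      using eq_tcoef[OF I_I[of 1 2], of "Gplus i" "Gminus j"] by (simp add: act_simps algebra_simps)
  qed (intro fin_supp_intros injI; simp)
  then show ?thesis by simp
qed

lemma I2_MP: "tcoef (d (basis_vec (Igen 2))) (Gminus i) (Gplus j) =
    tcoef (d (basis_vec (Igen 1))) (Gminus (i - 1)) (Gplus j) + tcoef (d (basis_vec (Igen 1))) (Gminus i) (Gplus (j - 1))"
proof -
  let ?f = "d (basis_vec (Igen 1))" and ?f2 = "d (basis_vec (Igen 2))"
  let ?F = "\<lambda>i j. tcoef ?f2 (Gminus i) (Gplus j)
    - (tcoef ?f (Gminus (i - 1)) (Gplus j) + tcoef ?f (Gminus i) (Gplus (j - 1)))"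
  have "?F i j = 0"
  proof (rule diagonal_cancel[where F = ?F])
    show "?F (i - 1) j = ?F i (j - 1)" for i j
      using eq_tcoef[OF I_I[of 1 2], of "Gminus i" "Gplus j"] by (simp add: act_simps algebra_simps)
  qed (intro fin_supp_intros injI; simp)
  then show ?thesis by simp
qed

lemma I2_LI: "tcoef (d (basis_vec (Igen 2))) (Lgen i) (Igen j) =
    2 * tcoef (d (basis_vec (Igen 1))) (Lgen i) (Igen (j - 1))"
  using eq_tcoef[OF relation_IP, of "Lgen i" "Gplus j"] by (simp add: act_simps I1_LL I2_MP algebra_simps)

lemma I2_IL: "tcoef (d (basis_vec (Igen 2))) (Igen i) (Lgen j) =
    2 * tcoef (d (basis_vec (Igen 1))) (Igen (i - 1)) (Lgen j)"
  using eq_tcoef[OF relation_IP, of "Gplus i" "Lgen j"] by (simp add: act_simps I1_LL I2_PM algebra_simps)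

text \<open>That is, \<open>xb = yc\<close>.  The \<open>II\<close> component of \<open>I\<^sub>1 * d(I\<^sub>2) = I\<^sub>2 * d(I\<^sub>1)\<close> says
  \<open>2xyb + 2xyc = 2x\<^sup>2b + 2y\<^sup>2c\<close>, which is this equation multiplied by \<open>x - y\<close>.\<close>

lemma I1_LI_IL: "tcoef (d (basis_vec (Igen 1))) (Lgen (i - 1)) (Igen j) = tcoef (d (basis_vec (Igen 1))) (Igen i) (Lgen (j - 1))"
proof -
  let ?f = "d (basis_vec (Igen 1))" and ?f2 = "d (basis_vec (Igen 2))"
  let ?F = "\<lambda>i j. tcoef ?f (Lgen (i - 1)) (Igen j) - tcoef ?f (Igen i) (Lgen (j - 1))"
  have "?F i j = 0"
  proof (rule diagonal_cancel[where F = ?F])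
    fix i j
    have "2 * ?F (i - 1) j = 2 * ?F i (j - 1)"
      using eq_tcoef[OF I_I[of 1 2], of "Igen i" "Igen j"] by (simp add: act_simps I2_LI I2_IL algebra_simps)
    then show "?F (i - 1) j = ?F i (j - 1)" by (rule mult_left_cancel[THEN iffD1, rotated]) simp
  qed (intro fin_supp_intros injI; simp)
  then show ?thesis by simp
qed

text \<open>By \<open>I1_LI_IL\<close>, \<open>b = ya\<close> and \<open>c = xa\<close> for one Laurent polynomial \<open>a\<close>, and these are the
  components of \<open>I\<^sub>1 * u\<close> when \<open>u\<close> is \<open>a\<close> placed in \<open>LL\<close>.\<close>

lemma LI_IL_exact:
  obtains u where "has_charge 0 u" "ns_act (basis_vec (Gplus 0)) u = 0"
    "\<And>i j. tcoef (d (basis_vec (Igen 1))) (Lgen i) (Igen j) = tcoef (ns_act (basis_vec (Igen 1)) u) (Lgen i) (Igen j)"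
    "\<And>i j. tcoef (d (basis_vec (Igen 1))) (Igen i) (Lgen j) = tcoef (ns_act (basis_vec (Igen 1)) u) (Igen i) (Lgen j)"
proof -
  let ?f = "d (basis_vec (Igen 1))"
  obtain u where u: "has_charge 0 u"
    "\<And>i j. tcoef u (Lgen i) (Lgen j) = tcoef ?f (Lgen i) (Igen (j + 1))"
    "\<And>i j. tcoef u (Lgen i) (Igen j) = 0"
    "\<And>i j. tcoef u (Igen i) (Lgen j) = 0"
    "\<And>i j. tcoef u (Igen i) (Igen j) = 0"
    "\<And>i j. tcoef u (Gplus i) (Gminus j) = 0"
    "\<And>i j. tcoef u (Gminus i) (Gplus j) = 0"
    by (rule charge_zero_tensor[of "\<lambda>i j. tcoef ?f (Lgen i) (Igen (j + 1))" "\<lambda>i j. 0" "\<lambda>i j. 0" "\<lambda>i j. 0" "\<lambda>i j. 0" "\<lambda>i j. 0"])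
      (auto intro!: fin_supp_intros injI)
  have "ns_act (basis_vec (Gplus 0)) u = 0"
  proof (rule charge_one_eqI)
    show "has_charge 1 (ns_act (basis_vec (Gplus 0)) u)" using charge_act[OF u(1), of "Gplus 0"] by simp
  qed (simp_all add: has_charge_def act_simps u)
  then show thesis
    by (rule that[OF u(1)]) (simp_all add: act_simps u I1_LI_IL)
qed

end

text \<open>What is left after \<open>b\<close> and \<open>c\<close> have been removed.\<close>

locale normal_cocycle = reduced_cocycle +
  assumes I1_LI: "tcoef (d (basis_vec (Igen 1))) (Lgen i) (Igen j) = 0"
    and I1_IL: "tcoef (d (basis_vec (Igen 1))) (Igen i) (Lgen j) = 0"
begin

text \<open>The components \<open>IP\<close> and \<open>PI\<close> of \<open>relation_IP\<close> both compute the \<open>II\<close> component of \<open>d(I\<^sub>2)\<close>;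
  comparing them yields \<open>2xh + 2yg = (y - x)e\<close>.\<close>

lemma I2_II:
  fixes i j :: int
  defines "f \<equiv> tcoef (d (basis_vec (Igen 1)))"
  shows "tcoef (d (basis_vec (Igen 2))) (Igen i) (Igen j)
     = 2 * f (Igen i) (Igen (j - 1)) - 4 * f (Gminus (i - 1)) (Gplus j)" (is ?A)
    and "2 * f (Gminus (i - 1)) (Gplus j) + 2 * f (Gplus i) (Gminus (j - 1)) =
      f (Igen i) (Igen (j - 1)) - f (Igen (i - 1)) (Igen j)" (is ?B)
proof -
  show A: ?A
    using eq_tcoef[OF relation_IP, of "Igen i" "Gplus j"]
    by (simp add: act_simps I1_LI I1_IL f_def algebra_simps)
  have "tcoef (d (basis_vec (Igen 2))) (Igen i) (Igen j)
     = 2 * f (Igen (i - 1)) (Igen j) + 4 * f (Gplus i) (Gminus (j - 1))"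
    using eq_tcoef[OF relation_IP, of "Gplus i" "Igen j"]
    by (simp add: act_simps I1_LI I1_IL f_def algebra_simps)
  with A show ?B by algebra
qed

text \<open>The \<open>IM\<close> component of \<open>relation_IM\<close>, divided by \<open>2x\<close>.  With \<open>p\<close> the \<open>LM\<close> component of
  \<open>d(M\<^sub>0)\<close> it reads \<open>2(g - h) = (x - y)p\<close>.  So \<open>g\<close> and \<open>h\<close> agree on the diagonal \<open>x = y\<close>; by
  \<open>I2_II\<close> they are also opposite there, hence both vanish on it.\<close>

lemma diagonal_difference:
  fixes i j :: int
  defines "f \<equiv> tcoef (d (basis_vec (Igen 1)))" and "v \<equiv> tcoef (d (basis_vec (Gminus (-1))))"
  shows "2 * (f (Gplus i) (Gminus j) - f (Gminus i) (Gplus j)) = v (Lgen (i - 1)) (Gminus j) - v (Lgen i) (Gminus (j - 1))"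
  using eq_tcoef[OF relation_IM, of "Igen (i + 1)" "Gminus j"]
  by (simp add: act_simps I1_LL I1_LI I1_IL I2_IL I2_PM I2_II(1) f_def v_def algebra_simps) algebra

text \<open>Eliminating \<open>h\<close> from \<open>2xh + 2yg = (y - x)e\<close> and \<open>2(g - h) = (x - y)p\<close> gives
  \<open>2(x + y)g = (x - y)(xp - e)\<close>, hence \<open>4xg = (x - y)(xp - e + 2g)\<close>.  This exhibits the quotient
  \<open>\<rho> = g / (x - y)\<close>; then \<open>\<eta> = p/2 - \<rho>\<close> is \<open>h / (y - x)\<close>.  Placing \<open>\<rho>\<close> in \<open>PM\<close> and \<open>\<eta>\<close>
  in \<open>MP\<close> produces \<open>g\<close> and \<open>h\<close>, and \<open>P\<^sub>0 * u = 0\<close> forces \<open>2\<eta>\<close> in \<open>LI\<close> and \<open>-2\<rho>\<close> in \<open>IL\<close>.\<close>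

lemma I1_exact:
  obtains u where "has_charge 0 u" "ns_act (basis_vec (Gplus 0)) u = 0"
    "d (basis_vec (Igen 1)) = ns_act (basis_vec (Igen 1)) u"
proof -
  let ?d = "d (basis_vec (Igen 1))"
  define f where "f = tcoef (d (basis_vec (Igen 1)))"
  define v where "v = tcoef (d (basis_vec (Gminus (-1))))"
  define \<rho> where "\<rho> i j = 1 / 4 * (v (Lgen i) (Gminus j) + (2 * f (Gplus (i + 1)) (Gminus j) - f (Igen (i + 1)) (Igen j)))"
    for i j
  define \<eta> where "\<eta> i j = 1 / 2 * v (Lgen i) (Gminus j) - \<rho> i j" for i j
  have fin: "fin_supp \<rho>" "fin_supp \<eta>"
    unfolding \<rho>_def \<eta>_def f_def v_def by (intro fin_supp_intros injI; simp)+
  obtain u where u: "has_charge 0 u"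
    "\<And>i j. tcoef u (Lgen i) (Lgen j) = 0"
    "\<And>i j. tcoef u (Lgen i) (Igen j) = 2 * \<eta> i j"
    "\<And>i j. tcoef u (Igen i) (Lgen j) = (- 2) * \<rho> i j"
    "\<And>i j. tcoef u (Igen i) (Igen j) = 0"
    "\<And>i j. tcoef u (Gplus i) (Gminus j) = \<rho> i j"
    "\<And>i j. tcoef u (Gminus i) (Gplus j) = \<eta> i j"
    by (rule charge_zero_tensor[of "\<lambda>i j. 0" "\<lambda>i j. 2 * \<eta> i j" "\<lambda>i j. (- 2) * \<rho> i j" "\<lambda>i j. 0" \<rho> \<eta>])
      (auto intro!: fin_supp_intros fin injI)
  have P: "ns_act (basis_vec (Gplus 0)) u = 0"
  proof (rule charge_one_eqI)
    show "has_charge 1 (ns_act (basis_vec (Gplus 0)) u)" using charge_act[OF u(1), of "Gplus 0"] by simp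
  qed (simp_all add: has_charge_def act_simps u)
  have D: "v (Lgen (i - 1)) (Gminus j) - v (Lgen i) (Gminus (j - 1))
      = 2 * (f (Gplus i) (Gminus j) - f (Gminus i) (Gplus j))" for i j
    unfolding f_def v_def diagonal_difference ..
  have S: "2 * f (Gminus (i - 1)) (Gplus j) + 2 * f (Gplus i) (Gminus (j - 1)) =
      f (Igen i) (Igen (j - 1)) - f (Igen (i - 1)) (Igen j)" for i j
    unfolding f_def by (rule I2_II(2))
  have g: "f (Gplus i) (Gminus j) = \<rho> (i - 1) j - \<rho> i (j - 1)" for i j
    using D[of i j] S[of "i + 1" j] unfolding \<rho>_def by simp algebra
  have h: "f (Gminus i) (Gplus j) = \<eta> i (j - 1) - \<eta> (i - 1) j" for i j
    using D[of i j] g[of i j] unfolding \<eta>_def by simp algebra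
  \<comment> \<open>\<open>e = 2x\<eta> - 2y\<rho>\<close> holds after multiplication by \<open>x - y\<close>, by substituting \<open>g\<close> and \<open>h\<close> in \<open>S\<close>.\<close>
  have e: "f (Igen i) (Igen j) = 2 * \<eta> (i - 1) j - 2 * \<rho> i (j - 1)" for i j
  proof -
    let ?F = "\<lambda>i j. f (Igen i) (Igen j) - (2 * \<eta> (i - 1) j - 2 * \<rho> i (j - 1))"
    have "?F i j = 0"
    proof (rule diagonal_cancel[where F = ?F])
      show "?F (i - 1) j = ?F i (j - 1)" for i j
        using S[of i j] unfolding g h by (simp add: algebra_simps)
      have "fin_supp (\<lambda>i j. \<eta> (i - 1) j)" "fin_supp (\<lambda>i j. \<rho> i (j - 1))"
        using fin_supp_reindex[OF fin(2), of "\<lambda>i. i - 1" "\<lambda>j. j"]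
          fin_supp_reindex[OF fin(1), of "\<lambda>i. i" "\<lambda>j. j - 1"] by (simp_all add: inj_def)
      then show "fin_supp ?F" unfolding f_def by (intro fin_supp_intros injI; simp)
    qed
    then show ?thesis by simp
  qed
  have "?d = ns_act (basis_vec (Igen 1)) u"
  proof (rule charge_zero_eqI)
    show "has_charge 0 ?d" using charge_of_value[of "Igen 1"] by simp
    show "has_charge 0 (ns_act (basis_vec (Igen 1)) u)" using charge_act[OF u(1), of "Igen 1"] by simp
  qed (simp_all add: act_simps u I1_LL I1_LI I1_IL g[unfolded f_def] h[unfolded f_def] e[unfolded f_def])
  with u(1) P show thesis by (rule that)
qed

end

lemma charge_one_I1_inj:
  assumes w: "has_charge 1 w" and I: "ns_act (basis_vec (Igen 1)) w = 0"
  shows "w = 0"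
proof (rule charge_one_eqI[OF w])
  note I' = eq_tcoef[OF I]
  show LP: "tcoef w (Lgen i) (Gplus j) = tcoef 0 (Lgen i) (Gplus j)" for i j
    using I'[of "Lgen i" "Gplus (j + 1)"] by (simp add: act_simps)
  show PL: "tcoef w (Gplus i) (Lgen j) = tcoef 0 (Gplus i) (Lgen j)" for i j
    using I'[of "Gplus (i + 1)" "Lgen j"] by (simp add: act_simps)
  show "tcoef w (Igen i) (Gplus j) = tcoef 0 (Igen i) (Gplus j)" for i j
    using I'[of "Igen i" "Gplus (j + 1)"] by (simp add: act_simps LP)
  show "tcoef w (Gplus i) (Igen j) = tcoef 0 (Gplus i) (Igen j)" for i j
    using I'[of "Gplus (i + 1)" "Igen j"] by (simp add: act_simps PL)
qed (simp add: has_charge_def)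

text \<open>Since \<open>d(P\<^sub>n\<^sub>+\<^sub>1) = I\<^sub>1 * d(P\<^sub>n)\<close> and \<open>I\<^sub>1\<close> is injective in charge one, all \<open>d(P\<^sub>n)\<close> vanish, in
  both directions from \<open>n = 0\<close>.  Then \<open>d(I\<^sub>n)\<close> is killed by \<open>I\<^sub>1\<close> and \<open>P\<^sub>0\<close> and so vanishes.  For
  \<open>v = d(M\<^sub>0)\<close> the relations \<open>I\<^sub>1 * I\<^sub>1 * v = - I\<^sub>2 * v\<close> and \<open>I\<^sub>1 * P\<^sub>0 * v = 0\<close> remain, the latter
  because \<open>[P\<^sub>0, M\<^sub>0] = 2 L'\<^sub>0\<close> and \<open>[I\<^sub>1, L'\<^sub>0] = I\<^sub>1\<close>; each of them loses a factor \<open>x - y\<close>.\<close>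

lemma (in reduced_cocycle) zero_if_I1_zero:
  assumes I1: "d (basis_vec (Igen 1)) = 0"
  shows "d = (\<lambda>x. 0)"
proof -
  have step: "d (basis_vec (Gplus (1 + n))) = ns_act (basis_vec (Igen 1)) (d (basis_vec (Gplus n)))" for n
    using I_P[of 1 n] by (simp add: I1 ns_lin)
  have P: "d (basis_vec (Gplus n)) = 0" for n
  proof (induction n rule: int_induct[where k = 0])
    case base show ?case by (rule d_P0)
  next
    case (step1 n) then show ?case using step[of n] by (simp add: add.commute ns_lin)
  next
    case (step2 n)
    show ?case
    proof (rule charge_one_I1_inj)
      show "has_charge 1 (d (basis_vec (Gplus (n - 1))))" using charge_of_value[of "Gplus (n - 1)"] by simp
      show "ns_act (basis_vec (Igen 1)) (d (basis_vec (Gplus (n - 1)))) = 0"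
        using step[of "n - 1"] step2.IH by simp
    qed
  qed
  have I: "d (basis_vec (Igen n)) = 0" for n
  proof (rule charge_zero_invariant_eq_zero)
    show "has_charge 0 (d (basis_vec (Igen n)))" using charge_of_value[of "Igen n"] by simp
    show "ns_act (basis_vec (Igen 1)) (d (basis_vec (Igen n))) = 0" using I_I[of 1 n] by (simp add: I1 ns_lin)
    show "ns_act (basis_vec (Gplus 0)) (d (basis_vec (Igen n))) = 0" using d_P[of n] by (simp add: P)
  qed
  have PM: "fscale 2 (d (basis_vec (Lgen (k + l + 1)))) = ns_act (basis_vec (Gplus k)) (d (basis_vec (Gminus l)))" for k l
    using even_Der_hom_basis[OF der, of "Gplus k" "Gminus l"] by (simp add: d.add d.scale I P ns_lin)
  define v where "v = d (basis_vec (Gminus (-1)))"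
  have square: "ns_act (basis_vec (Igen 1)) (ns_act (basis_vec (Igen 1)) v) = - ns_act (basis_vec (Igen 2)) v"
    using relation_IM[symmetric] by (simp add: I v_def ns_lin)
  have "ns_act (basis_vec (Igen 1)) (d (basis_vec (Lgen 0))) = 0"
    using even_Der_hom_basis[OF der, of "Igen 1" "Lgen 0"] by (simp add: d.scale I ns_lin)
  then have comm: "ns_act (basis_vec (Igen 1)) (ns_act (basis_vec (Gplus 0)) v) = 0"
    using PM[of 0 "-1"] actr.scale[of "basis_vec (Igen 1)" 2 "d (basis_vec (Lgen 0))"] by (simp add: v_def)
  \<comment> \<open>the first relation gives \<open>x\<^sup>2 = xy\<close> on the \<open>LM\<close> component and \<open>y\<^sup>2 = xy\<close> on \<open>ML\<close>\<close>
  have v_LM: "tcoef v (Lgen i) (Gminus j) = 0" for i j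
  proof (rule diagonal_cancel)
    show "tcoef v (Lgen (i - 1)) (Gminus j) = tcoef v (Lgen i) (Gminus (j - 1))" for i j
      using eq_tcoef[OF square, of "Igen (i + 1)" "Gminus j"] by (simp add: act_simps algebra_simps)
  qed (intro fin_supp_intros injI; simp)
  have v_ML: "tcoef v (Gminus i) (Lgen j) = 0" for i j
  proof (rule diagonal_cancel)
    show "tcoef v (Gminus (i - 1)) (Lgen j) = tcoef v (Gminus i) (Lgen (j - 1))" for i j
      using eq_tcoef[OF square, of "Gminus i" "Igen (j + 1)"] by (simp add: act_simps algebra_simps)
  qed (intro fin_supp_intros injI; simp)
  \<comment> \<open>\<open>P\<^sub>0\<close> turns \<open>IM\<close> into \<open>PM\<close> and \<open>MI\<close> into \<open>MP\<close>, where \<open>I\<^sub>1\<close> acts by \<open>\<plusminus>(x - y)\<close>\<close>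
  have v_IM: "tcoef v (Igen i) (Gminus j) = 0" for i j
  proof (rule diagonal_cancel)
    show "tcoef v (Igen (i - 1)) (Gminus j) = tcoef v (Igen i) (Gminus (j - 1))" for i j
      using eq_tcoef[OF comm, of "Gplus i" "Gminus j"] by (simp add: act_simps v_LM algebra_simps)
  qed (intro fin_supp_intros injI; simp)
  have v_MI: "tcoef v (Gminus i) (Igen j) = 0" for i j
  proof (rule diagonal_cancel)
    show "tcoef v (Gminus (i - 1)) (Igen j) = tcoef v (Gminus i) (Igen (j - 1))" for i j
      using eq_tcoef[OF comm, of "Gminus i" "Gplus j"] by (simp add: act_simps v_ML algebra_simps)
  qed (intro fin_supp_intros injI; simp)
  have "v = 0"
  proof (rule charge_minus_one_eqI)
    show "has_charge (-1) v" using charge_of_value[of "Gminus (-1)"] by (simp add: v_def)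
  qed (simp_all add: has_charge_def v_LM v_ML v_IM v_MI)
  then have M: "d (basis_vec (Gminus n)) = 0" for n
    using I_M[of "n + 1" 0] by (simp add: I v_def ns_lin)
  have L: "d (basis_vec (Lgen n)) = 0" for n
    using PM[of 0 "n - 1"] by (simp add: M ns_lin)
  show ?thesis
  proof (rule linear_zeroI_basis)
    show "Vector_Spaces.linear fscale fscale d" by (rule Der_hom_linear) (rule der)
    show "d (basis_vec a) = 0" for a by (cases a) (simp_all add: L I P M)
  qed
qed

lemma inner_if_reduction_inner:
  assumes "d \<in> NS.Der_hom 0" "has_charge 0 u" "(\<lambda>x. d x - inn 0 u x) \<in> NS.Inn_hom 0"
  shows "d \<in> NS.Inn_hom 0"
proof -
  have i: "inn 0 u \<in> NS.Inn_hom 0" by (intro inn_in_Inn_hom even_if_charge_zero assms)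
  have "(\<lambda>x. (d x - inn 0 u x) - ((\<lambda>x. 0) x - inn 0 u x)) \<in> NS.Inn_hom 0"
    by (intro NS.Inn_hom_diff assms i NS.Inn_hom_zero)
  then show ?thesis by simp
qed


lemma even_Der_hom_inner: 
  assumes d: "d \<in> NS.Der_hom 0" and I0: "d (basis_vec (Igen 0)) = 0"
  shows "d \<in> NS.Inn_hom 0"
proof -
  interpret even_cocycle d by unfold_locales (rule d I0)+
  obtain u where u: "has_charge 0 u" "d (basis_vec (Gplus 0)) = ns_act (basis_vec (Gplus 0)) u"
    by (rule P0_exact)
  define d1 where "d1 = (\<lambda>x. d x - inn 0 u x)"
  interpret d1: reduced_cocycle d1
    unfolding d1_def using u(2)
    by (intro reduced_cocycle.intro reduced_cocycle_axioms.intro subtract_inner u(1))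
      (simp add: inn_basis_vec ksign_def)
  obtain u' where u': "has_charge 0 u'" "ns_act (basis_vec (Gplus 0)) u' = 0"
    "\<And>i j. tcoef (d1 (basis_vec (Igen 1))) (Lgen i) (Igen j) = tcoef (ns_act (basis_vec (Igen 1)) u') (Lgen i) (Igen j)"
    "\<And>i j. tcoef (d1 (basis_vec (Igen 1))) (Igen i) (Lgen j) = tcoef (ns_act (basis_vec (Igen 1)) u') (Igen i) (Lgen j)"
    by (rule d1.LI_IL_exact) blast
  define d2 where "d2 = (\<lambda>x. d1 x - inn 0 u' x)"
  interpret d2: normal_cocycle d2
    unfolding d2_def
    by (intro normal_cocycle.intro normal_cocycle_axioms.intro d1.subtract_inner_reduced u'(1,2))
      (simp_all add: inn_basis_vec ksign_def u'(3,4))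
  obtain u'' where u'': "has_charge 0 u''" "ns_act (basis_vec (Gplus 0)) u'' = 0"
    "d2 (basis_vec (Igen 1)) = ns_act (basis_vec (Igen 1)) u''"
    by (rule d2.I1_exact)
  define d3 where "d3 = (\<lambda>x. d2 x - inn 0 u'' x)"
  interpret d3: reduced_cocycle d3
    unfolding d3_def by (intro d2.subtract_inner_reduced u''(1,2))
  have "d3 = (\<lambda>x. 0)"
    by (rule d3.zero_if_I1_zero) (simp add: d3_def inn_basis_vec ksign_def u''(3))
  then have "d3 \<in> NS.Inn_hom 0" by (simp add: NS.Inn_hom_zero)
  then have "d2 \<in> NS.Inn_hom 0" using inner_if_reduction_inner[OF d2.der u''(1)] by (simp add: d3_def)
  then have "d1 \<in> NS.Inn_hom 0" using inner_if_reduction_inner[OF d1.der u'(1)] by (simp add: d2_def)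
  then show ?thesis using inner_if_reduction_inner[OF der u(1)] by (simp add: d1_def)
qed

lemma Der_hom_inner:
  assumes d: "d \<in> NS.Der_hom p"
  shows "d \<in> NS.Inn_hom p"
proof -
  obtain u where u: "u \<in> ns_tensor_gr p" "d (basis_vec (Igen 0)) = inn p u (basis_vec (Igen 0))"
    using Der_hom_reduce_I0[OF d] .
  note inn = inn_in_Inn_hom[OF u(1)]
  define e where "e = (\<lambda>x. d x - inn p u x)"
  have "inn p u \<in> NS.Der_hom p" using inn NS.Inn_hom_subset_Der_hom by blast
  then have e: "e \<in> NS.Der_hom p" unfolding e_def by (rule NS.Der_hom_diff[OF d])
  have e0: "e (basis_vec (Igen 0)) = 0" by (simp add: e_def u)
  have "e \<in> NS.Inn_hom p"
  proof (cases p)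
    case zero then show ?thesis using even_Der_hom_inner[of e] e e0 by simp
  next
    case one then show ?thesis using odd_Der_hom_zero[of e] e e0 NS.Inn_hom_zero[of p] by simp
  qed
  then have "(\<lambda>x. e x - ((\<lambda>x. 0) x - inn p u x)) \<in> NS.Inn_hom p"
    by (intro NS.Inn_hom_diff inn NS.Inn_hom_zero)
  then show ?thesis by (simp add: e_def)
qed

theorem theorem3p1:
  shows "NS.Der = NS.Inn \<and> NS.H1 = {NS.Inn}"
  using NS.Der_eq_InnI[OF Der_hom_inner] NS.H1_eq_singleton by blast

end
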